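(* Let $\nu$ be a probability measure on $\mathbb{R}_+=(0,\infty)$ which is multiplicatively symmetric and log-unimodal. Then for every $t>0$ the free multiplicative convolution $\sigma_t\boxtimes\nu$ is multiplicatively symmetric and log-unimodal. In particular, the measure $\sigma_t$ itself is log-unimodal for every $t>0$.
   Context: $\mathbb{R}_+=(0,\infty)$. Unimodality: a positive Borel measure $\mu$ on $\mathbb{R}$ is unimodal with mode $a\in\mathbb{R}$ if $\mu=c\,\delta_a+f(x)\,dx$ where $c\in[0,\infty]$ and $f:\mathbb{R}\to[0,\infty)$ is non-decreasing on $(-\infty,a)$ and non-increasing on $(a,\infty)$. A positive Borel measure $\mu$ on $\mathbb{R}_+$ is log-unimodal with mode $a\in\mathbb{R}_+$ if its push-forward $\log_*\mu$ under $\log:\mathbb{R}_+\to\mathbb{R}$ is unimodal with mode $\log a$; it is log-unimodal if this holds for some $a\in\mathbb{R}_+$. Multiplicative symmetry: for a Borel measure $\mu$ on $\mathbb{R}_+$, $\mu^{-1}$ denotes its push-forward under $x\mapsto 1/x$; $\mu$ is multiplicatively symmetric if $\mu=\mu^{-1}$. Free multiplicative convolution: for a probability measure $\mu$ on $\mathbb{R}_+$ put $\psi_\mu(z)=\int_0^\infty\frac{xz}{1-xz}\,d\mu(x)$ for $z\in\mathbb{C}\setminus[0,\infty)$ and $\eta_\mu=\psi_\mu/(1+\psi_\mu)$. The function $\eta_\mu$ has an analytic compositional inverse $\eta_\mu^{-1}$ in a neighborhood of $(-\infty,0)$, and the $\Sigma$-transform is $\Sigma_\mu(z)=\eta_\mu^{-1}(z)/z$;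 it determines $\mu$ uniquely. For probability measures $\mu,\nu$ on $\mathbb{R}_+$, $\mu\boxtimes\nu$ is the probability measure on $\mathbb{R}_+$ determined by $\Sigma_{\mu\boxtimes\nu}(z)=\Sigma_\mu(z)\Sigma_\nu(z)$ for $z\in(-\infty,0)$ (equivalently, it is the distribution of $X^{1/2}YX^{1/2}$ for freely independent non-negative self-adjoint operators $X,Y$ affiliated with a finite von Neumann algebra, with distributions $\mu,\nu$). Free positive multiplicative Brownian motion: for $t>0$, $\sigma_t$ is the ($\boxtimes$-infinitely divisible) probability measure on $\mathbb{R}_+$ with $\Sigma_{\sigma_t}(z)=\exp\left(\frac t2\cdot\frac{z+1}{z-1}\right)$. *)

theory Defs
  imports "HOL-Probability.Probability"
begin

text \<open>The set-wise form of \<open>c \<delta>\<^sub>a + f(x) dx\<close>.  Note \<open>\<infinity> * 0 = 0\<close> in \<open>ennreal\<close>, so \<open>c = \<infinity>\<close>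
  is harmless; measurability of \<open>f\<close> follows from the monotonicity conditions.\<close>

definition unimodal_mode :: "real measure \<Rightarrow> real \<Rightarrow> bool" where
  "unimodal_mode \<mu> a \<longleftrightarrow>
     sets \<mu> = sets borel \<and>
     (\<exists>(c::ennreal) (f::real \<Rightarrow> real).
        (\<forall>x. 0 \<le> f x) \<and> mono_on {..<a} f \<and> antimono_on {a<..} f \<and>
        (\<forall>A\<in>sets borel.
           emeasure \<mu> A = c * indicator A a + (\<integral>\<^sup>+x\<in>A. ennreal (f x) \<partial>lborel)))"

text \<open>A Borel measure on the open half-line is a measure whose space is the subspace
  \<open>{0<..}\<close> itself, so no mass at or below zero is possible.\<close>

abbreviation borel_pos :: "real measure" where
  "borel_pos \<equiv> restrict_space borel {0<..}"

definition prob_on_pos :: "real measure \<Rightarrow> bool" where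
  "prob_on_pos \<mu> \<longleftrightarrow> prob_space \<mu> \<and> sets \<mu> = sets borel_pos"

definition log_unimodal_mode :: "real measure \<Rightarrow> real \<Rightarrow> bool" where
  "log_unimodal_mode \<mu> a \<longleftrightarrow>
     sets \<mu> = sets borel_pos \<and> 0 < a \<and> unimodal_mode (distr \<mu> borel ln) (ln a)"

definition log_unimodal :: "real measure \<Rightarrow> bool" where
  "log_unimodal \<mu> \<longleftrightarrow> (\<exists>a. log_unimodal_mode \<mu> a)"

definition mult_inverse :: "real measure \<Rightarrow> real measure" where
  "mult_inverse \<mu> = distr \<mu> borel_pos (\<lambda>x. 1 / x)"

definition mult_symmetric :: "real measure \<Rightarrow> bool" where
  "mult_symmetric \<mu> \<longleftrightarrow> sets \<mu> = sets borel_pos \<and> \<mu> = mult_inverse \<mu>"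

text \<open>Meaningful for \<open>z\<close> off \<open>[0,\<infinity>)\<close>, where the integrand is bounded.\<close>

definition psi_transform :: "real measure \<Rightarrow> complex \<Rightarrow> complex" where
  "psi_transform \<mu> z =
     (\<integral>x. complex_of_real x * z / (1 - complex_of_real x * z) \<partial>\<mu>)"

definition eta_transform :: "real measure \<Rightarrow> complex \<Rightarrow> complex" where
  "eta_transform \<mu> z = psi_transform \<mu> z / (1 + psi_transform \<mu> z)"

definition neg_axis :: "complex set" where
  "neg_axis = complex_of_real ` {..<0}"

text \<open>For a probability measure \<open>\<mu>\<close> on \<open>(0,\<infinity>)\<close> the map \<open>eta_transform \<mu>\<close> restricts to a
  bijection of \<open>(-\<infinity>,0)\<close> onto itself, with nonvanishing derivative; its inverse there is
  the restriction of the analytic inverse defined in a complex neighbourhood.  The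
  convolution only involves the values on \<open>(-\<infinity>,0)\<close>, and the definition is meant
  for such \<open>z\<close> only.\<close>

definition Sigma_transform :: "real measure \<Rightarrow> complex \<Rightarrow> complex" where
  "Sigma_transform \<mu> z = the_inv_into neg_axis (eta_transform \<mu>) z / z"

text \<open>The two descriptions below are proper for probability measures \<open>\<mu>\<close>, \<open>\<nu>\<close> on \<open>(0,\<infinity>)\<close>
  and for \<open>t > 0\<close>, respectively, by theorems of Bercovici and Voiculescu.\<close>

definition free_mult_conv :: "real measure \<Rightarrow> real measure \<Rightarrow> real measure"
    (infixl \<open>\<boxtimes>\<close> 70) where
  "\<mu> \<boxtimes> \<nu> = (THE \<rho>. prob_on_pos \<rho> \<and>
     (\<forall>z\<in>neg_axis. Sigma_transform \<rho> z = Sigma_transform \<mu> z * Sigma_transform \<nu> z))"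

definition free_mult_BM :: "real \<Rightarrow> real measure" where
  "free_mult_BM t = (THE \<sigma>. prob_on_pos \<sigma> \<and>
     (\<forall>z\<in>neg_axis. Sigma_transform \<sigma> z = exp (complex_of_real t / 2 * ((z + 1) / (z - 1)))))"

end

theory Submission imports Defs "HOL-Complex_Analysis.Complex_Analysis"
begin

text \<open>In logarithmic coordinates the theorem becomes a statement about conformal maps of a strip.
Let \<open>M\<close> be the image of \<open>\<nu>\<close> under \<open>ln\<close>, a symmetric probability measure on the line, and
put \<open>T z = \<integral> tanh ((z - s) / 2) dM(s)\<close> on the strip \<open>\<bar>Im z\<bar> < \<pi>\<close>.  By symmetry
\<open>1 + 2 \<psi>\<^sub>\<nu>(-e\<^sup>x) = - T x\<close>, so \<open>w = \<eta>\<^sub>\<nu>(-e\<^sup>x)\<close> satisfies \<open>(w + 1) / (w - 1) = T x\<close>.  Hence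
a symmetric measure \<open>\<rho>\<close> has \<open>\<Sigma>\<^sub>\<rho>(w) = exp (t/2 (w + 1)/(w - 1)) \<Sigma>\<^sub>\<nu>(w)\<close> on the negative axis
exactly when its own \<open>T\<close>-function takes the value \<open>T x\<close> at the point \<open>H x\<close>, where
\<open>H z = z + t/2 T z\<close>.  The task is to invert \<open>H\<close> and to recognise \<open>R = T \<circ> H\<^sup>-\<^sup>1\<close> as the
\<open>T\<close>-function of a symmetric unimodal measure.

\<^bold>\<open>Inversion.\<close>  Let \<open>\<Omega>\<close> be the part of the strip that \<open>H\<close> maps into the strip.  For fixed \<open>x\<close>
the quotient \<open>Im T(x + iy) / (\<pi> - y)\<close> increases with \<open>y \<ge> 0\<close> (\<open>Im_T_ratio\<close>).  This makes
\<open>Im H\<close> strictly increasing along the vertical segments of \<open>\<Omega>\<close> and \<open>Re H' > 0\<close> on \<open>\<Omega>\<close>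
(\<open>Re_deriv_H_pos\<close>).  So each level set \<open>Im H = \<theta>\<close> is a graph over the real axis, and along it
\<open>Re H\<close> increases strictly through all real values: \<open>H\<close> is a bijection of \<open>\<Omega>\<close> onto the strip, with
a holomorphic inverse \<open>G\<close> (\<open>H_inj\<close>, \<open>H_image\<close>).

\<^bold>\<open>Density.\<close>  Cauchy's formula on long rectangles expresses a bounded function on the closed strip by
its imaginary part on the line \<open>Im z = \<pi>\<close> (\<open>strip_representation\<close>).  Since \<open>R\<close> need not extend to that
line, the formula is applied to \<open>z \<mapsto> R (\<lambda> z)\<close> with \<open>\<lambda> < 1\<close>.  The densities so obtained are even,
bounded by \<open>2 / t\<close> and decreasing on the positive half-line, so that Helly's theorem yields a limit
density with the same properties as \<open>\<lambda> \<rightarrow> 1\<close> (\<open>density_exists\<close>).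

\<^bold>\<open>Unimodality.\<close>  From \<open>G w = w - t/2 R w\<close> follows \<open>Im R w = 2/t (Im w - Im (G w))\<close>: the densities
decrease because the level curves of \<open>Im H\<close> in the upper half-plane rise with \<open>\<bar>x\<bar>\<close>.  They rise because
\<open>Im T(x + iy)\<close> decreases in \<open>x \<ge> 0\<close> for fixed \<open>y \<ge> 0\<close>; it is the convolution of \<open>M\<close> with a symmetric unimodal kernel, and such a
convolution is again symmetric unimodal by Wintner's theorem (\<open>Im_T_antimono\<close>).

Finally the \<open>\<Sigma>\<close>-transform on the negative axis determines the measure (\<open>Sigma_transform_inj\<close>).  Hence
the measures just constructed are the ones that \<open>free_mult_BM\<close> and \<open>\<boxtimes>\<close> describe; the former
arises from \<open>\<nu> = \<delta>\<^sub>1\<close>, whose \<open>\<Sigma>\<close>-transform is \<open>1\<close>.\<close>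

section \<open>Differentiation under the integral sign\<close>

text \<open>The uniform bound on the derivative bounds all difference quotients on the convex set, so dominated
convergence applies to them.\<close>

lemma has_field_derivative_integral:
  fixes f f' :: "complex \<Rightarrow> 'a \<Rightarrow> complex"
  assumes "finite_measure M" and S: "open S" "convex S" and z: "z \<in> S"
    and f': "\<And>w x. w \<in> S \<Longrightarrow> ((\<lambda>w. f w x) has_field_derivative f' w x) (at w)"
    and bound: "\<And>w x. w \<in> S \<Longrightarrow> norm (f' w x) \<le> B"
    and int: "\<And>w. w \<in> S \<Longrightarrow> integrable M (f w)"
    and meas: "f' z \<in> borel_measurable M"
  shows "((\<lambda>w. \<integral>x. f w x \<partial>M) has_field_derivative (\<integral>x. f' z x \<partial>M)) (at z)"
proof -
  interpret finite_measure M by fact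
  have "((\<lambda>w. \<integral>x. f w x \<partial>M) has_field_derivative (\<integral>x. f' z x \<partial>M)) (at z within S)"
    unfolding has_field_derivative_iff tendsto_at_iff_sequentially comp_def
  proof (intro allI impI)
    fix X assume X: "\<forall>i. X i \<in> S - {z}" "X \<longlonglongrightarrow> z"
    have "(\<lambda>i. \<integral>x. (f (X i) x - f z x) / (X i - z) \<partial>M) \<longlonglongrightarrow> (\<integral>x. f' z x \<partial>M)"
    proof (rule integral_dominated_convergence[where w="\<lambda>_. B"])
      show "(\<lambda>x. (f (X i) x - f z x) / (X i - z)) \<in> borel_measurable M" for i
        using int[of "X i"] int[OF z] X(1) by (intro borel_measurable_divide borel_measurable_diff) auto
      show "AE x in M. (\<lambda>i. (f (X i) x - f z x) / (X i - z)) \<longlonglongrightarrow> f' z x"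
      proof (rule AE_I2)
        fix x
        have "((\<lambda>w. f w x) has_field_derivative f' z x) (at z within S)"
          using f'[OF z] has_field_derivative_at_within by blast
        then show "(\<lambda>i. (f (X i) x - f z x) / (X i - z)) \<longlonglongrightarrow> f' z x"
          unfolding has_field_derivative_iff tendsto_at_iff_sequentially comp_def using X by blast
      qed
      show "AE x in M. norm ((f (X i) x - f z x) / (X i - z)) \<le> B" for i
      proof (rule AE_I2)
        fix x
        have "norm (f (X i) x - f z x) \<le> B * norm (X i - z)"
          using X z by (intro field_differentiable_bound[OF S(2), of _ "\<lambda>w. f' w x"])
            (auto intro: has_field_derivative_at_within f' bound)
        then show "norm ((f (X i) x - f z x) / (X i - z)) \<le> B"
          using X(1) by (auto simp: norm_divide divide_le_eq)
      qed
    qed (use meas in auto)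
    moreover have "(\<integral>x. (f (X i) x - f z x) / (X i - z) \<partial>M)
        = ((\<integral>x. f (X i) x \<partial>M) - (\<integral>x. f z x \<partial>M)) / (X i - z)" for i
      using int[of "X i"] int[OF z] X(1) by (subst Bochner_Integration.integral_diff[symmetric]) auto
    ultimately show "(\<lambda>i. ((\<integral>x. f (X i) x \<partial>M) - (\<integral>x. f z x \<partial>M)) / (X i - z)) \<longlonglongrightarrow> (\<integral>x. f' z x \<partial>M)"
      by (simp only:)
  qed
  then show ?thesis using at_within_open[OF z S(1)] by simp
qed

section \<open>The hyperbolic tangent of the half argument\<close>

text \<open>This is \<open>tanh (z / 2)\<close>.  The form with a single exponential is defined on the whole strip
\<open>\<bar>Im z\<bar> < \<pi>\<close> and substitutes \<open>exp (ln s) = s\<close> directly.\<close>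

definition htanh :: "'a \<Rightarrow> 'a::{real_normed_field,banach}" where
  "htanh z = 1 - 2 / (exp z + 1)"

lemma of_real_htanh: "of_real (htanh x) = (htanh (of_real x) :: 'a::{real_normed_field,banach})"
  by (simp add: htanh_def exp_of_real)

lemma cos_gt_minus_one: "\<bar>y\<bar> < pi \<Longrightarrow> -1 < cos y"
  using cos_monotone_0_pi[of "\<bar>y\<bar>" pi] by simp

lemma cosh_plus_cos_pos: "\<bar>y\<bar> < pi \<Longrightarrow> 0 < cosh x + cos (y::real)"
  using cos_gt_minus_one[of y] cosh_real_ge_1[of x] by linarith

lemma norm_exp_plus_one: "norm (exp z + 1) ^ 2 = 2 * exp (Re z) * (cosh (Re z) + cos (Im z))"
proof -
  have "norm (exp z + 1) ^ 2 = (exp (Re z) * cos (Im z) + 1)^2 + (exp (Re z) * sin (Im z))^2"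
    by (simp add: cmod_power2 Re_exp Im_exp)
  also have "\<dots> = exp (Re z)^2 * ((cos (Im z))^2 + (sin (Im z))^2) + 2 * exp (Re z) * cos (Im z) + 1"
    by algebra
  also have "\<dots> = 2 * exp (Re z) * (cosh (Re z) + cos (Im z))"
    by (simp add: cosh_field_def field_simps power2_eq_square exp_minus)
  finally show ?thesis .
qed

lemma exp_plus_one_nonzero:
  assumes "\<bar>Im z\<bar> < pi" shows "exp z + 1 \<noteq> 0"
proof
  assume "exp z + 1 = 0"
  then have "2 * exp (Re z) * (cosh (Re z) + cos (Im z)) = 0"
    using norm_exp_plus_one[of z] by simp
  then show False using cosh_plus_cos_pos[OF assms, of "Re z"] by simp
qed

text \<open>The real and imaginary parts have the common denominator \<open>cosh (Re z) + cos (Im z)\<close>, which is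
positive in the open strip; all later estimates come from this formula.\<close>

lemma htanh_eq:
  assumes "\<bar>Im z\<bar> < pi"
  shows "htanh z = Complex (sinh (Re z) / (cosh (Re z) + cos (Im z)))
                           (sin (Im z) / (cosh (Re z) + cos (Im z)))"
proof -
  let ?d = "cosh (Re z) + cos (Im z)"
  have d: "?d > 0" by (rule cosh_plus_cos_pos[OF assms])
  have "htanh z = (exp z - 1) / (exp z + 1)"
    using exp_plus_one_nonzero[OF assms] by (simp add: htanh_def field_simps)
  also have "\<dots> = (exp z - 1) * cnj (exp z + 1) / of_real (2 * exp (Re z) * ?d)"
    by (subst complex_div_cnj) (simp add: norm_exp_plus_one)
  also have "(exp z - 1) * cnj (exp z + 1) = 
    Complex (2 * exp (Re z) * sinh (Re z)) (2 * exp (Re z) * sin (Im z))"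
  proof (rule complex_eqI)
    have "(sin (Im z))^2 + (cos (Im z))^2 = 1" by simp
    then have "exp (Re z) ^2 * (sin (Im z))^2 + exp (Re z)^2 * (cos (Im z))^2 = exp (Re z)^2"
      by (metis distrib_left mult.right_neutral)
    then show "Re ((exp z - 1) * cnj (exp z + 1)) = Re (Complex (2 * exp (Re z) * sinh (Re z)) (2 * exp (Re z) * sin (Im z)))"
      by (simp add: sinh_field_def Re_exp Im_exp field_simps power2_eq_square exp_minus)
    show "Im ((exp z - 1) * cnj (exp z + 1)) = Im (Complex (2 * exp (Re z) * sinh (Re z)) (2 * exp (Re z) * sin (Im z)))"
      by (simp add: Re_exp Im_exp algebra_simps)
  qed
  also have "\<dots> / of_real (2 * exp (Re z) * ?d) = Complex (sinh (Re z) / ?d) (sin (Im z) / ?d)"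
    using d by (intro complex_eqI) (simp_all add: Re_divide_of_real Im_divide_of_real)
  finally show ?thesis .
qed

lemma Re_htanh: "\<bar>Im z\<bar> < pi \<Longrightarrow> Re (htanh z) = sinh (Re z) / (cosh (Re z) + cos (Im z))"
  and Im_htanh: "\<bar>Im z\<bar> < pi \<Longrightarrow> Im (htanh z) = sin (Im z) / (cosh (Re z) + cos (Im z))"
  by (simp_all add: htanh_eq)

lemma htanh_minus: "\<bar>Im z\<bar> < pi \<Longrightarrow> htanh (-z) = - htanh z"
  by (simp add: htanh_eq complex_eq_iff)

lemma htanh_cnj: "htanh (cnj z) = cnj (htanh z)"
  by (simp add: htanh_def exp_cnj)

lemma has_field_derivative_htanh:
  assumes "\<bar>Im z\<bar> < pi"
  shows "(htanh has_field_derivative 2 * exp z / (exp z + 1)^2) (at z)"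
  unfolding htanh_def[abs_def] using exp_plus_one_nonzero[OF assms]
  by (auto intro!: derivative_eq_intros simp: power2_eq_square)

lemma cosh_plus_cos_ge:
  assumes "\<bar>y\<bar> \<le> \<theta>" "\<theta> < pi" shows "1 + cos \<theta> \<le> cosh x + cos (y::real)"
proof -
  have "cos \<theta> \<le> cos \<bar>y\<bar>" using assms by (intro cos_monotone_0_pi_le) auto
  then show ?thesis using cosh_real_ge_1[of x] by simp
qed

lemma norm_htanh_deriv_le:
  assumes "\<bar>Im z\<bar> \<le> \<theta>" "\<theta> < pi"
  shows "norm (2 * exp z / (exp z + 1)^2) \<le> 1 / (1 + cos \<theta>)"
proof -
  have p: "1 + cos \<theta> > 0" using cos_gt_minus_one[of \<theta>] assms by auto
  have "norm (2 * exp z / (exp z + 1)^2) = 2 * exp (Re z) / norm (exp z + 1)^2"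
    by (simp add: norm_divide norm_mult norm_power)
  also have "\<dots> = 1 / (cosh (Re z) + cos (Im z))"
    by (simp add: norm_exp_plus_one)
  also have "\<dots> \<le> 1 / (1 + cos \<theta>)"
    using cosh_plus_cos_ge[OF assms, of "Re z"] p by (intro divide_left_mono mult_pos_pos) auto
  finally show ?thesis .
qed

lemma norm_htanh_le:
  assumes "\<bar>Im z\<bar> \<le> \<theta>" "\<theta> < pi"
  shows "norm (htanh z) \<le> 1 + 2 / (1 + cos \<theta>)"
proof -
  have p: "1 + cos \<theta> > 0" using cos_gt_minus_one[of \<theta>] assms by auto
  let ?d = "cosh (Re z) + cos (Im z)"
  have d: "1 + cos \<theta> \<le> ?d" by (rule cosh_plus_cos_ge[OF assms])
  have i: "\<bar>Im z\<bar> < pi" using assms by auto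
  have inv: "1 / ?d \<le> 1 / (1 + cos \<theta>)" using d p by (intro divide_left_mono mult_pos_pos) auto
  have "\<bar>sinh (Re z)\<bar> \<le> cosh (Re z)"
    using exp_gt_zero[of "Re z"] exp_gt_zero[of "- Re z"]
    by (simp only: abs_le_iff sinh_field_def cosh_field_def) (simp add: field_simps)
  also have "\<dots> \<le> ?d + 1" using cos_le_one[of "Im z"] cos_ge_minus_one[of "Im z"] by linarith
  finally have "\<bar>sinh (Re z)\<bar> / ?d \<le> 1 + 1 / ?d"
    using divide_right_mono[of "\<bar>sinh (Re z)\<bar>" "?d + 1" ?d] d p by (simp add: add_divide_distrib)
  then have "\<bar>Re (htanh z)\<bar> \<le> 1 + 1 / (1 + cos \<theta>)"
    using inv d p i by (simp add: Re_htanh abs_divide)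
  moreover have "\<bar>sin (Im z)\<bar> / ?d \<le> 1 / ?d" using d p by (intro divide_right_mono) auto
  then have "\<bar>Im (htanh z)\<bar> \<le> 1 / (1 + cos \<theta>)"
    using inv d p i by (simp add: Im_htanh abs_divide)
  ultimately show ?thesis using cmod_le[of "htanh z"] by auto
qed

lemma measurable_htanh [measurable]: "(htanh :: complex \<Rightarrow> complex) \<in> borel_measurable borel"
  unfolding htanh_def[abs_def] 
  by (intro borel_measurable_diff borel_measurable_divide borel_measurable_add borel_measurable_const borel_measurable_continuous_onI) (auto intro!: continuous_intros)

lemma measurable_htanh_real [measurable]: "(htanh :: real \<Rightarrow> real) \<in> borel_measurable borel"
  unfolding htanh_def[abs_def] by measurable

section \<open>The transform of a symmetric distribution\<close>

text \<open>The derivative of \<open>sin x / x\<close> has the sign of \<open>x cos x - sin x\<close>, which vanishes at \<open>0\<close> and has the derivative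
\<open>- x sin x \<le> 0\<close> on \<open>[0, \<pi>]\<close>.\<close>

lemma sin_ratio_mono:
  assumes "0 < b" "b \<le> c" "c \<le> pi"
  shows "sin c * b \<le> sin b * c"
proof -
  have h: "0 \<le> sin x - x * cos x" if "0 \<le> x" "x \<le> pi" for x :: real
  proof -
    have "sin 0 - 0 * cos 0 \<le> sin x - x * cos x"
      using that
      by (intro DERIV_nonneg_imp_nondecreasing[where f="\<lambda>x. sin x - x * cos x"])
        (auto intro!: exI derivative_eq_intros simp: mult_nonneg_nonneg sin_ge_zero)
    then show ?thesis by simp
  qed
  have "sin c / c \<le> sin b / b"
  proof (rule DERIV_nonpos_imp_nonincreasing[where f="\<lambda>x. sin x / x"])
    fix x assume x: "b \<le> x" "x \<le> c"
    then have "((\<lambda>x. sin x / x) has_real_derivative (cos x * x - sin x) / (x * x)) (at x)"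
      using assms by (auto intro!: derivative_eq_intros)
    moreover have "(cos x * x - sin x) / (x * x) \<le> 0"
      using h[of x] x assms by (intro divide_nonpos_nonneg) (auto simp: mult.commute)
    ultimately show "\<exists>y. ((\<lambda>x. sin x / x) has_real_derivative y) (at x) \<and> y \<le> 0" by blast
  qed (use assms in auto)
  then show ?thesis using assms by (simp add: field_simps)
qed

locale symmetric_distribution = real_distribution M for M :: "real measure" +
  assumes distr_uminus: "distr M borel uminus = M"
begin

text \<open>The kernel replaces the Cauchy kernel \<open>1 / (z - s)\<close> of additive free probability.  The
imaginary part of \<open>T\<close> on the upper edge of the strip is \<open>2 \<pi>\<close> times the density of the measure.\<close>

definition T :: "complex \<Rightarrow> complex" where
  "T z = (\<integral>s. htanh (z - of_real s) \<partial>M)"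

lemma integrable_htanh:
  assumes "\<bar>Im z\<bar> < pi" shows "integrable M (\<lambda>s. htanh (z - complex_of_real s))"
  by (rule integrable_const_bound[where B="1 + 2 / (1 + cos \<bar>Im z\<bar>)"])
    (use norm_htanh_le[of "z - complex_of_real s" "\<bar>Im z\<bar>" for s] assms in auto)

lemma norm_T_le:
  assumes "\<bar>Im z\<bar> \<le> \<theta>" "\<theta> < pi" shows "norm (T z) \<le> 1 + 2 / (1 + cos \<theta>)"
proof -
  have "norm (T z) \<le> (\<integral>s. norm (htanh (z - complex_of_real s)) \<partial>M)"
    unfolding T_def by (rule integral_norm_bound)
  also have "\<dots> \<le> (\<integral>s. 1 + 2 / (1 + cos \<theta>) \<partial>M)"
    using assms norm_htanh_le[of "z - complex_of_real s" \<theta> for s] integrable_htanh[of z]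
    by (intro integral_mono integrable_norm) auto
  finally show ?thesis using prob_space by simp
qed

lemma T_differentiable:
  assumes "\<bar>Im z\<bar> < pi" shows "\<exists>D. (T has_field_derivative D) (at z)"
proof -
  define \<theta> where "\<theta> = (\<bar>Im z\<bar> + pi) / 2"
  have \<theta>: "\<bar>Im z\<bar> < \<theta>" "\<theta> < pi" using assms by (auto simp: \<theta>_def)
  let ?S = "{z. Im z < \<theta>} \<inter> {z. Im z > -\<theta>}"
  have "((\<lambda>w. \<integral>s. htanh (w - complex_of_real s) \<partial>M) has_field_derivative
      (\<integral>s. 2 * exp (z - complex_of_real s) / (exp (z - complex_of_real s) + 1)^2 \<partial>M)) (at z)"
  proof (rule has_field_derivative_integral[where S="?S" and B="1 / (1 + cos \<theta>)"])
    show "finite_measure M" by (rule finite_measure_axioms)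
    show "open ?S" by (intro open_Int open_halfspace_Im_lt open_halfspace_Im_gt)
    show "convex ?S" by (intro convex_Int convex_halfspace_Im_lt convex_halfspace_Im_gt)
    show "z \<in> ?S" using \<theta> by auto
    show "((\<lambda>w. htanh (w - complex_of_real s)) has_field_derivative
        2 * exp (w - complex_of_real s) / (exp (w - complex_of_real s) + 1)^2) (at w)" if "w \<in> ?S" for w s
    proof -
      have i: "\<bar>Im (w - complex_of_real s)\<bar> < pi" using that \<theta> by auto
      have "((\<lambda>w. htanh (w - complex_of_real s)) has_field_derivative
        2 * exp (w - complex_of_real s) / (exp (w - complex_of_real s) + 1)^2 * 1) (at w)"
        by (rule DERIV_chain2[where g="\<lambda>w. w - complex_of_real s", OF has_field_derivative_htanh[OF i]])
          (auto intro!: derivative_eq_intros)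
      then show ?thesis by simp
    qed
    show "norm (2 * exp (w - complex_of_real s) / (exp (w - complex_of_real s) + 1)^2) \<le> 1 / (1 + cos \<theta>)"
      if "w \<in> ?S" for w s
      using norm_htanh_deriv_le[of "w - complex_of_real s" \<theta>] that \<theta> by auto
    show "integrable M (\<lambda>s. htanh (w - complex_of_real s))" if "w \<in> ?S" for w
      using that \<theta> by (intro integrable_htanh) auto
    have "(\<lambda>s. exp (z - complex_of_real s)) \<in> borel_measurable M"
      by (intro measurable_compose[OF _ borel_measurable_continuous_onI[of exp]] continuous_intros) auto
    then show "(\<lambda>s. 2 * exp (z - complex_of_real s) / (exp (z - complex_of_real s) + 1)^2) \<in> borel_measurable M"
      by simp
  qed
  then show ?thesis unfolding T_def[abs_def] by blast
qed

lemma T_holomorphic: "T holomorphic_on {z. \<bar>Im z\<bar> < pi}"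
  unfolding holomorphic_on_def field_differentiable_def
  using T_differentiable has_field_derivative_at_within by blast

lemma T_cnj: "T (cnj z) = cnj (T z)"
proof -
  have "htanh (cnj z - complex_of_real s) = cnj (htanh (z - complex_of_real s))" for s
    using htanh_cnj[of "z - complex_of_real s"] by simp
  then show ?thesis unfolding T_def by simp
qed

lemma T_minus: assumes "\<bar>Im z\<bar> < pi" shows "T (-z) = - T z"
proof -
  have "T (-z) = (\<integral>s. htanh (-z - complex_of_real s) \<partial>(distr M borel uminus))"
    unfolding T_def distr_uminus ..
  also have "\<dots> = (\<integral>s. htanh (-z - complex_of_real (-s)) \<partial>M)"
    by (subst integral_distr) auto
  also have "\<dots> = (\<integral>s. - htanh (z - complex_of_real s) \<partial>M)"
    using assms by (intro Bochner_Integration.integral_cong refl)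
      (subst htanh_minus[symmetric], auto)
  finally show ?thesis by (simp add: T_def)
qed

lemma Im_T:
  assumes "\<bar>y\<bar> < pi" shows "Im (T (Complex x y)) = (\<integral>s. sin y / (cosh (x - s) + cos y) \<partial>M)"
  and integrable_Im_T: "integrable M (\<lambda>s. sin y / (cosh (x - s) + cos y))"
proof -
  have *: "Im (htanh (Complex x y - complex_of_real s)) = sin y / (cosh (x - s) + cos y)" for s
    using assms by (subst Im_htanh) auto
  have i: "integrable M (\<lambda>s. htanh (Complex x y - complex_of_real s))"
    using assms by (intro integrable_htanh) auto
  show "Im (T (Complex x y)) = (\<integral>s. sin y / (cosh (x - s) + cos y) \<partial>M)"
    unfolding T_def using integral_Im[OF i] by (simp only: *)
  show "integrable M (\<lambda>s. sin y / (cosh (x - s) + cos y))"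
    using integrable_Im[OF i] by (simp only: *)
qed

lemma Im_T_nonneg:
  assumes "0 \<le> y" "y < pi" shows "0 \<le> Im (T (Complex x y))"
proof -
  have "0 \<le> sin y / (cosh (x - s) + cos y)" for s
    using assms cosh_plus_cos_pos[of y "x - s"] by (intro divide_nonneg_pos sin_ge_zero) auto
  then have "0 \<le> (\<integral>s. sin y / (cosh (x - s) + cos y) \<partial>M)" by (rule Bochner_Integration.integral_nonneg)
  then show ?thesis using assms by (subst Im_T) auto
qed

text \<open>With \<open>b = \<pi> - y\<close> the integrand divided by \<open>b\<close> is \<open>(sin b / b) / (cosh (x - s) - cos b)\<close>; both
factors decrease in \<open>b \<in> (0, \<pi>)\<close>.\<close>

lemma Im_T_ratio:
  assumes "0 \<le> y1" "y1 < y2" "y2 < pi"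
  shows "Im (T (Complex x y1)) * (pi - y2) \<le> Im (T (Complex x y2)) * (pi - y1)"
proof -
  have *: "sin y1 / (c + cos y1) * (pi - y2) \<le> sin y2 / (c + cos y2) * (pi - y1)" if "c \<ge> 1" for c
  proof -
    have a: "cos y2 \<le> cos y1" "-1 < cos y2"
      using assms by (auto intro!: cos_monotone_0_pi_le cos_gt_minus_one)
    have b: "sin y1 * (pi - y2) \<le> sin y2 * (pi - y1)"
      using sin_ratio_mono[of "pi - y2" "pi - y1"] assms by simp
    have "sin y1 * (pi - y2) / (c + cos y1) \<le> sin y1 * (pi - y2) / (c + cos y2)"
      using a assms that by (intro divide_left_mono mult_nonneg_nonneg sin_ge_zero mult_pos_pos) auto
    also have "\<dots> \<le> sin y2 * (pi - y1) / (c + cos y2)"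
      using a b that by (intro divide_right_mono) auto
    finally show ?thesis by simp
  qed
  have "(\<integral>s. sin y1 / (cosh (x - s) + cos y1) * (pi - y2) \<partial>M)
     \<le> (\<integral>s. sin y2 / (cosh (x - s) + cos y2) * (pi - y1) \<partial>M)"
    using assms by (intro integral_mono integrable_mult_left integrable_Im_T * cosh_real_ge_1) auto
  then show ?thesis using assms by (simp only: integral_mult_left_zero Im_T)
qed

end

section \<open>The conformal map of the flow\<close>

text \<open>The parameter \<open>t\<close> is the time of the free multiplicative Brownian motion started at the measure
whose logarithmic image is \<open>M\<close>.\<close>

locale free_flow = symmetric_distribution +
  fixes t :: real
  assumes t_pos: "t > 0"
begin

text \<open>In logarithmic coordinates \<open>H\<close> multiplies \<open>\<eta>\<^sup>-\<^sup>1\<close> by the \<open>\<Sigma>\<close>-transform of \<open>\<sigma>\<^sub>t\<close>: it carries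
the point where the initial measure attains a value of \<open>\<eta>\<close> to the point where the measure at time
\<open>t\<close> attains it.\<close>

definition H :: "complex \<Rightarrow> complex" where "H z = z + of_real (t/2) * T z"

definition \<Omega> :: "complex set" where "\<Omega> = {z. \<bar>Im z\<bar> < pi \<and> \<bar>Im (H z)\<bar> < pi}"

lemma H_holomorphic: "H holomorphic_on {z. \<bar>Im z\<bar> < pi}"
  unfolding H_def[abs_def] by (intro holomorphic_intros T_holomorphic)

lemma open_strip: "open {z. \<bar>Im z\<bar> < c}"
proof -
  have "{z. \<bar>Im z\<bar> < c} = {z. Im z < c} \<inter> {z. Im z > - c}" by auto
  then show ?thesis by (auto intro!: open_Int open_halfspace_Im_lt open_halfspace_Im_gt)
qed

lemma H_deriv: "\<bar>Im z\<bar> < pi \<Longrightarrow> (H has_field_derivative deriv H z) (at z)"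
  using H_holomorphic open_strip holomorphic_derivI by fastforce

lemma H_isCont: "\<bar>Im z\<bar> < pi \<Longrightarrow> isCont H z"
  using H_deriv DERIV_isCont by blast

lemma H_cnj: "H (cnj z) = cnj (H z)"
  by (simp add: H_def T_cnj)

lemma H_minus: "\<bar>Im z\<bar> < pi \<Longrightarrow> H (-z) = - H z"
  by (simp add: H_def T_minus)

lemma Im_H: "Im (H z) = Im z + t/2 * Im (T z)"
  by (simp add: H_def Im_divide_of_real)

lemma Im_H_odd: "\<bar>y\<bar> < pi \<Longrightarrow> Im (H (Complex x (-y))) = - Im (H (Complex x y))"
proof -
  have "Complex x (-y) = cnj (Complex x y)" by (simp add: complex_eq_iff)
  then have "H (Complex x (-y)) = cnj (H (Complex x y))" using H_cnj by metis
  then show ?thesis by simp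
qed

lemma Im_H_ge: "0 \<le> y \<Longrightarrow> y < pi \<Longrightarrow> y \<le> Im (H (Complex x y))"
  using Im_T_nonneg[of y x] t_pos by (simp add: Im_H)

text \<open>For \<open>b = \<pi> - y\<close> one has \<open>\<pi> - Im H = b (1 - t/2 (Im T / b))\<close>, and the second factor decreases with \<open>y\<close>
by \<open>Im_T_ratio\<close>.  Replacing its value at \<open>y1\<close> by the smaller one at \<open>y2\<close> gives the bound.  The slope
on the left is positive as long as \<open>Im H < \<pi>\<close> at the upper point, in particular on \<open>\<Omega>\<close>.\<close>

lemma Im_H_gap:
  assumes "0 \<le> y1" "y1 < y2" "y2 < pi"
  shows "(y2 - y1) * ((pi - Im (H (Complex x y2))) / (pi - y2))
     \<le> Im (H (Complex x y2)) - Im (H (Complex x y1))"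
proof -
  define A1 A2 where "A1 = t/2 * Im (T (Complex x y1))" and "A2 = t/2 * Im (T (Complex x y2))"
  have "A1 * (pi - y2) \<le> A2 * (pi - y1)"
    unfolding A1_def A2_def using Im_T_ratio[OF assms, of x] t_pos by simp
  then have "- (y2 - y1) * A2 \<le> (A2 - A1) * (pi - y2)" by (simp add: algebra_simps)
  then have "(y2 - y1) * (pi - y2 - A2) \<le> (y2 - y1 + A2 - A1) * (pi - y2)"
    by (simp add: algebra_simps)
  then have "(y2 - y1) * (pi - y2 - A2) / (pi - y2) \<le> y2 - y1 + A2 - A1"
    using assms by (simp add: divide_le_eq)
  then show ?thesis by (simp add: Im_H A1_def A2_def algebra_simps)
qed

text \<open>\<open>Im H\<close> need not be monotone on a whole vertical segment of the strip, but for \<open>\<bar>\<theta>\<bar> < \<pi>\<close> it crosses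
the level \<open>\<theta>\<close> only once, and upwards.\<close>

lemma level_crossing:
  assumes "\<bar>\<theta>\<bar> < pi" "-pi < y1" "y1 < y2" "y2 < pi" "Im (H (Complex x y2)) \<le> \<theta>"
  shows "Im (H (Complex x y1)) < \<theta>"
proof -
  have pos: "Im (H (Complex x u)) < Im (H (Complex x v))"
    if "0 \<le> u" "u < v" "v < pi" "Im (H (Complex x v)) < pi" for u v
  proof -
    have "0 < (v - u) * ((pi - Im (H (Complex x v))) / (pi - v))" using that by simp
    then show ?thesis using Im_H_gap[of u v x] that by linarith
  qed
  consider "0 \<le> y1" | "y2 \<le> 0" | "y1 < 0" "0 < y2" using assms by linarith
  then show ?thesis
  proof cases
    case 1
    then show ?thesis using pos[of y1 y2] assms unfolding abs_less_iff by linarith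
  next
    case 2
    show ?thesis
    proof (rule ccontr)
      assume n: "\<not> ?thesis"
      have "Im (H (Complex x (-y2))) < Im (H (Complex x (-y1)))"
        using n 2 assms Im_H_odd[of y1 x] by (intro pos) auto
      then show False using n 2 assms Im_H_odd[of y1 x] Im_H_odd[of y2 x] by auto
    qed
  next
    case 3
    then have "0 < Im (H (Complex x y2))" "0 < Im (H (Complex x (-y1)))"
      using Im_H_ge[of y2 x] Im_H_ge[of "-y1" x] assms by auto
    then show ?thesis using 3 assms Im_H_odd[of y1 x] by auto
  qed
qed

lemma isCont_Complex_y: "isCont (\<lambda>y. Complex x y) y"
  and isCont_Complex_x: "isCont (\<lambda>x. Complex x y) x"
  by (simp_all add: Complex_eq)

text \<open>The bound \<open>\<bar>y\<bar> \<le> \<bar>\<theta>\<bar>\<close> holds because \<open>Im H (x + iy) \<ge> y\<close> for \<open>y \<ge> 0\<close>.  It keeps the level curves away from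
the edge of the strip, where \<open>T\<close> is unbounded.\<close>

lemma level_exists:
  assumes "\<bar>\<theta>\<bar> < pi"
  shows "\<exists>y. \<bar>y\<bar> \<le> \<bar>\<theta>\<bar> \<and> Im (H (Complex x y)) = \<theta>"
proof -
  have nonneg: "\<exists>y. \<bar>y\<bar> \<le> \<theta> \<and> Im (H (Complex x y)) = \<theta>" if "0 \<le> \<theta>" "\<theta> < pi" for \<theta>
  proof -
    have "\<exists>y\<ge>0. y \<le> \<theta> \<and> Im (H (Complex x y)) = \<theta>"
    proof (rule IVT)
      show "Im (H (Complex x 0)) \<le> \<theta>" using Im_H_odd[of 0 x] that by simp
      show "\<theta> \<le> Im (H (Complex x \<theta>))" using Im_H_ge that by simp
      show "\<forall>y. 0 \<le> y \<and> y \<le> \<theta> \<longrightarrow> isCont (\<lambda>y. Im (H (Complex x y))) y"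
        using that by (auto intro!: isCont_Im isCont_o2[OF isCont_Complex_y H_isCont])
    qed (use that in auto)
    then show ?thesis by force
  qed
  show ?thesis
  proof (cases "0 \<le> \<theta>")
    case True then show ?thesis using nonneg[of \<theta>] assms by auto
  next
    case False
    then obtain y where "\<bar>y\<bar> \<le> -\<theta>" "Im (H (Complex x y)) = -\<theta>"
      using nonneg[of "-\<theta>"] assms by auto
    then show ?thesis using Im_H_odd[of y x] False assms by (intro exI[of _ "-y"]) auto
  qed
qed

lemma level_unique:
  assumes "\<bar>\<theta>\<bar> < pi" "\<bar>y1\<bar> < pi" "\<bar>y2\<bar> < pi"
    "Im (H (Complex x y1)) = \<theta>" "Im (H (Complex x y2)) = \<theta>"
  shows "y1 = y2"
  using level_crossing[of \<theta> y1 y2 x] level_crossing[of \<theta> y2 y1 x] assms by linarith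

definition level :: "real \<Rightarrow> real \<Rightarrow> real" where
  "level \<theta> x = (THE y. \<bar>y\<bar> < pi \<and> Im (H (Complex x y)) = \<theta>)"

lemma level_eqI:
  assumes "\<bar>y\<bar> < pi" "\<bar>Im (H (Complex x y))\<bar> < pi"
  shows "level (Im (H (Complex x y))) x = y"
  unfolding level_def using assms by (intro the_equality) (auto intro: level_unique)

lemma level:
  assumes "\<bar>\<theta>\<bar> < pi"
  shows abs_level: "\<bar>level \<theta> x\<bar> \<le> \<bar>\<theta>\<bar>" and Im_H_level: "Im (H (Complex x (level \<theta> x))) = \<theta>"
proof -
  obtain y where y: "\<bar>y\<bar> \<le> \<bar>\<theta>\<bar>" "Im (H (Complex x y)) = \<theta>" using level_exists[OF assms] by blast
  with level_eqI[of y x] assms have "level \<theta> x = y" by auto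
  with y show "\<bar>level \<theta> x\<bar> \<le> \<bar>\<theta>\<bar>" "Im (H (Complex x (level \<theta> x))) = \<theta>" by auto
qed

text \<open>Just below the level curve at \<open>x0\<close> the value of \<open>Im H\<close> is less than \<open>\<theta>\<close>, and it stays so for nearby \<open>x\<close>, so that
the curve cannot drop below that height; the same holds from above.\<close>

lemma isCont_level:
  assumes "\<bar>\<theta>\<bar> < pi" shows "isCont (level \<theta>) x0"
  unfolding isCont_def
proof (rule order_tendstoI)
  have ev: "isCont (\<lambda>x. Im (H (Complex x y))) x0" if "\<bar>y\<bar> < pi" for y
    using that by (intro isCont_Im isCont_o2[OF isCont_Complex_x H_isCont]) auto
  have L: "\<bar>level \<theta> x\<bar> < pi" for x using abs_level[OF assms, of x] assms by linarith
  fix a assume "a < level \<theta> x0"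
  then have "max a (-pi) < level \<theta> x0" using L[of x0] by auto
  then obtain a' where a': "max a (-pi) < a'" "a' < level \<theta> x0" using dense by blast
  then have a'pi: "\<bar>a'\<bar> < pi" using L[of x0] by auto
  have "Im (H (Complex x0 a')) < \<theta>"
    using level_crossing[of \<theta> a' "level \<theta> x0" x0] L[of x0] a' assms Im_H_level[OF assms] by auto
  then have "eventually (\<lambda>x. Im (H (Complex x a')) < \<theta>) (at x0)"
    using ev[OF a'pi] unfolding isCont_def by (auto dest: order_tendstoD(2))
  then show "eventually (\<lambda>x. a < level \<theta> x) (at x0)"
  proof eventually_elim
    case (elim x)
    have "- pi < level \<theta> x" "a' < pi" using L[of x] a'pi by auto
    then have "a' < level \<theta> x"
      using level_crossing[of \<theta> "level \<theta> x" a' x] elim assms Im_H_level[OF assms, of x]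
      by (cases "level \<theta> x" a' rule: linorder_cases) auto
    then show ?case using a' by auto
  qed
next
  have ev: "isCont (\<lambda>x. Im (H (Complex x y))) x0" if "\<bar>y\<bar> < pi" for y
    using that by (intro isCont_Im isCont_o2[OF isCont_Complex_x H_isCont]) auto
  have L: "\<bar>level \<theta> x\<bar> < pi" for x using abs_level[OF assms, of x] assms by linarith
  fix b assume "level \<theta> x0 < b"
  then have "level \<theta> x0 < min b pi" using L[of x0] by auto
  then obtain b' where b': "b' < min b pi" "level \<theta> x0 < b'" using dense by blast
  then have b'pi: "\<bar>b'\<bar> < pi" using L[of x0] by auto
  have "Im (H (Complex x0 b')) > \<theta>"
    using level_crossing[of \<theta> "level \<theta> x0" b' x0] L[of x0] b' b'pi assms Im_H_level[OF assms, of x0] 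
    by fastforce
  then have "eventually (\<lambda>x. Im (H (Complex x b')) > \<theta>) (at x0)"
    using ev[OF b'pi] unfolding isCont_def by (auto dest: order_tendstoD(1))
  then show "eventually (\<lambda>x. level \<theta> x < b) (at x0)"
  proof eventually_elim
    case (elim x)
    have "level \<theta> x < pi" "- pi < b'" using L[of x] b'pi by auto
    then have "level \<theta> x < b'"
      using level_crossing[of \<theta> b' "level \<theta> x" x] elim assms Im_H_level[OF assms, of x]
      by (cases "level \<theta> x" b' rule: linorder_cases) auto
    then show ?case using b' by auto
  qed
qed

lemma Im_H_vertical_deriv:
  assumes "\<bar>y\<bar> < pi" "(H has_field_derivative D) (at (Complex x y))"
  shows "((\<lambda>y. Im (H (Complex x y))) has_real_derivative Re D) (at y)"
proof -
  have "((\<lambda>y. Complex x y) has_vector_derivative \<i>) (at y)"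
    unfolding Complex_eq by (auto intro!: derivative_eq_intros)
  then have "(H \<circ> (\<lambda>y. Complex x y) has_vector_derivative (\<i> * D)) (at y)"
    using field_vector_diff_chain_at[of "\<lambda>y. Complex x y" \<i> y H D] assms by simp
  then have "((\<lambda>y. Im (H (Complex x y))) has_vector_derivative Im (\<i> * D)) (at y)"
    using bounded_linear.has_vector_derivative[OF bounded_linear_Im] by (simp only: comp_def)
  then show ?thesis by (simp add: has_real_derivative_iff_has_vector_derivative)
qed

text \<open>By the Cauchy-Riemann equations \<open>Re H'\<close> is the derivative of \<open>Im H\<close> in the vertical direction, whose
difference quotients from below are bounded below by \<open>Im_H_gap\<close>.  On the real axis the quotient from above
is at least \<open>1\<close> by \<open>Im_H_ge\<close>.\<close>

lemma Re_deriv_H_pos_upper: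
  assumes "z \<in> \<Omega>" "0 \<le> Im z" shows "0 < Re (deriv H z)"
proof -
  obtain x y where z: "z = Complex x y" by (cases z)
  \<comment> \<open>a lower bound for the vertical difference quotients: from below if \<open>y > 0\<close>, from above if \<open>y = 0\<close>\<close>
  define c where "c = (if y = 0 then 1 else (pi - Im (H z)) / (pi - y))"
  have yp: "0 \<le> y" "y < pi" "\<bar>Im (H (Complex x y))\<bar> < pi" using assms z by (auto simp: \<Omega>_def)
  then have cpos: "c > 0" by (auto simp: c_def z)
  have d: "((\<lambda>y. Im (H (Complex x y)) - c * y) has_real_derivative (Re (deriv H z) - c)) (at y)"
    using DERIV_diff[OF Im_H_vertical_deriv[of y "deriv H z" x] DERIV_cmult_Id[of c]] H_deriv[of z] yp
    by (simp add: z)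
  have "\<not> Re (deriv H z) - c < 0"
  proof
    assume neg: "Re (deriv H z) - c < 0"
    show False
    proof (cases "y = 0")
      case True
      from DERIV_neg_dec_right[OF d neg] obtain d where d: "d > 0"
        and *: "\<And>h. h > 0 \<Longrightarrow> h < d \<Longrightarrow> Im (H (Complex x y)) - c * y > Im (H (Complex x (y + h))) - c * (y + h)"
        by blast
      define h where "h = min (d/2) 1"
      have h: "h > 0" "h < d" "h < pi" using d pi_gt3 by (auto simp: h_def)
      have "Im (H (Complex x 0)) = 0" using Im_H_odd[of 0 x] by simp
      then show False using *[OF h(1,2)] Im_H_ge[of h x] h True by (simp add: c_def)
    next
      case False
      from DERIV_neg_dec_left[OF d neg] obtain d where d: "d > 0"
        and *: "\<And>h. h > 0 \<Longrightarrow> h < d \<Longrightarrow> Im (H (Complex x y)) - c * y < Im (H (Complex x (y - h))) - c * (y - h)"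
        by blast
      define h where "h = min (d/2) y"
      have h: "h > 0" "h < d" "h \<le> y" using d yp False by (auto simp: h_def)
      have "h * c \<le> Im (H (Complex x y)) - Im (H (Complex x (y - h)))"
        using Im_H_gap[of "y - h" y x] h yp False by (simp add: c_def z)
      then show False using *[OF h(1,2)] by (simp add: algebra_simps)
    qed
  qed
  then show ?thesis using cpos by linarith
qed

lemma Re_deriv_H_pos:
  assumes "z \<in> \<Omega>" shows "0 < Re (deriv H z)"
proof (cases "0 \<le> Im z")
  case True then show ?thesis using Re_deriv_H_pos_upper assms by blast
next
  case False
  have z: "\<bar>Im z\<bar> < pi" using assms by (auto simp: \<Omega>_def)
  have "((\<lambda>z. H (- z)) has_field_derivative deriv H (-z) * (-1)) (at z)"
    by (rule DERIV_chain2[where g=uminus]) (use H_deriv[of "-z"] z in \<open>auto intro!: derivative_eq_intros\<close>)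
  from DERIV_minus[OF this]
  have "((\<lambda>z. - H (- z)) has_field_derivative deriv H (-z)) (at z)" by simp
  then have "(H has_field_derivative deriv H (-z)) (at z)"
    by (rule has_field_derivative_transform_within_open[OF _ open_strip[of pi]])
      (use z in \<open>auto simp: H_minus\<close>)
  then have "deriv H z = deriv H (-z)" by (rule DERIV_imp_deriv)
  moreover have "-z \<in> \<Omega>" using assms by (auto simp: \<Omega>_def H_minus)
  ultimately show ?thesis using Re_deriv_H_pos_upper[of "-z"] False by auto
qed

end

lemma abs_htanh_le: "\<bar>htanh x\<bar> \<le> (1::real)"
proof -
  have "0 < exp x + 1" by (simp add: add_pos_pos)
  then have "0 \<le> 2 / (exp x + 1)" "2 / (exp x + 1) \<le> 2" by (simp_all add: divide_le_eq)
  then show ?thesis unfolding htanh_def by linarith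
qed

lemma htanh_at_top: "((\<lambda>x::real. htanh (x - s)) \<longlongrightarrow> 1) at_top"
proof -
  have "filterlim (\<lambda>x::real. exp (x - s) + 1) at_top at_top"
    using filterlim_tendsto_add_at_top[OF tendsto_const[of 1] filterlim_compose[OF exp_at_top
      filterlim_tendsto_add_at_top[OF tendsto_const[of "-s"] filterlim_ident[of at_top]]]]
    by (simp add: add.commute)
  then have "((\<lambda>x::real. 1 - 2 / (exp (x - s) + 1)) \<longlongrightarrow> 1 - 0) at_top"
    by (intro tendsto_diff tendsto_const real_tendsto_divide_at_top[OF tendsto_const])
  then show ?thesis by (simp add: htanh_def)
qed

context symmetric_distribution
begin

lemma T_of_real: "T (of_real x) = of_real (\<integral>s. htanh (x - s) \<partial>M)"
proof -
  have "htanh (complex_of_real x - complex_of_real s) = of_real (htanh (x - s))" for s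
    by (simp add: of_real_htanh)
  then show ?thesis unfolding T_def by simp
qed

lemma T_at_top: "((\<lambda>x. T (of_real x)) \<longlongrightarrow> 1) at_top"
proof -
  have "((\<lambda>x. \<integral>s. htanh (x - s) \<partial>M) \<longlongrightarrow> (\<integral>s. 1 \<partial>M)) at_top"
    by (rule integral_dominated_convergence_at_top[where w="\<lambda>_. 1"])
      (auto simp: abs_htanh_le intro!: htanh_at_top)
  then have "((\<lambda>x. complex_of_real (\<integral>s. htanh (x - s) \<partial>M)) \<longlongrightarrow> of_real 1) at_top"
    using prob_space by (intro tendsto_of_real) simp
  then show ?thesis by (simp only: T_of_real of_real_1)
qed

end

context free_flow
begin

text \<open>Along a level curve \<open>c\<close> the increment of \<open>H\<close> is real.  So
\<open>(c x - c x0) / (Re (H (c x)) - Re (H (c x0)))\<close> tends to \<open>1 / H'\<close>, and its real part shows that the reciprocal of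
the derivative sought is \<open>Re (1 / H') > 0\<close>.\<close>

lemma curve_derivative:
  assumes \<theta>: "\<bar>\<theta>\<bar> < pi"
  shows "\<exists>D>0. ((\<lambda>x. Re (H (Complex x (level \<theta> x)))) has_real_derivative D) (at x0)"
proof -
  define c where "c x = Complex x (level \<theta> x)" for x
  define X where "X x = Re (H (c x))" for x
  define D where "D = deriv H (c x0)"
  have lpi: "\<bar>level \<theta> x\<bar> < pi" for x using abs_level[OF \<theta>, of x] \<theta> by linarith
  have "c x0 \<in> \<Omega>" using lpi[of x0] Im_H_level[OF \<theta>] \<theta> by (simp add: \<Omega>_def c_def)
  then have D: "Re D > 0" unfolding D_def by (rule Re_deriv_H_pos)
  have HX: "H (c x) - H (c x0) = of_real (X x - X x0)" for x
    using Im_H_level[OF \<theta>] by (simp add: complex_eq_iff X_def c_def)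
  have "isCont c x0" unfolding c_def Complex_eq using isCont_level[OF \<theta>] by (intro continuous_intros)
  moreover have "eventually (\<lambda>x. c x \<noteq> c x0) (at x0)"
    by (auto simp: eventually_at c_def intro!: exI[of _ 1])
  ultimately have c: "filterlim c (at (c x0)) (at x0)"
    by (simp add: filterlim_at isCont_def)
  have "((\<lambda>z. (H z - H (c x0)) / (z - c x0)) \<longlongrightarrow> D) (at (c x0))"
    using H_deriv[of "c x0"] lpi[of x0] by (simp add: D_def has_field_derivative_iff c_def)
  from filterlim_compose[OF this c]
  have "((\<lambda>x. of_real (X x - X x0) / (c x - c x0)) \<longlongrightarrow> D) (at x0)" by (simp only: HX)
  then have "((\<lambda>x. inverse (of_real (X x - X x0) / (c x - c x0))) \<longlongrightarrow> inverse D) (at x0)"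
    using D by (intro tendsto_inverse) auto
  then have "((\<lambda>x. Re ((c x - c x0) / of_real (X x - X x0))) \<longlongrightarrow> Re (inverse D)) (at x0)"
    by (intro tendsto_Re) simp
  then have "((\<lambda>x. (x - x0) / (X x - X x0)) \<longlongrightarrow> Re (inverse D)) (at x0)"
    by (simp add: Re_divide_of_real c_def flip: of_real_diff)
  moreover have "0 < Re (inverse D)"
    using D by (auto intro!: divide_pos_pos add_pos_nonneg)
  ultimately have "((\<lambda>x. inverse ((x - x0) / (X x - X x0))) \<longlongrightarrow> inverse (Re (inverse D))) (at x0)"
    by (intro tendsto_inverse) auto
  then have "(X has_real_derivative inverse (Re (inverse D))) (at x0)"
    by (simp add: has_field_derivative_iff)
  moreover have "0 < inverse (Re (inverse D))"
    using \<open>0 < Re (inverse D)\<close> positive_imp_inverse_positive by blast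
  ultimately show ?thesis unfolding X_def c_def by blast
qed

lemma curve_strict_mono:
  assumes \<theta>: "\<bar>\<theta>\<bar> < pi" and "x < x'"
  shows "Re (H (Complex x (level \<theta> x))) < Re (H (Complex x' (level \<theta> x')))"
  using assms(2) by (rule DERIV_pos_imp_increasing) (use curve_derivative[OF \<theta>] in blast)

lemma Re_H_bound:
  assumes "\<bar>Im z\<bar> \<le> \<theta>" "\<theta> < pi"
  shows "\<bar>Re (H z) - Re z\<bar> \<le> t/2 * (1 + 2 / (1 + cos \<theta>))"
proof -
  have "\<bar>Re (H z) - Re z\<bar> = t/2 * \<bar>Re (T z)\<bar>" using t_pos by (simp add: H_def abs_mult)
  also have "\<dots> \<le> t/2 * (1 + 2 / (1 + cos \<theta>))"
    using abs_Re_le_cmod[of "T z"] norm_T_le[OF assms] t_pos by (intro mult_left_mono) auto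
  finally show ?thesis .
qed

text \<open>On a level curve \<open>T\<close> is bounded, so \<open>Re H\<close> differs from the abscissa by a bounded amount.\<close>

lemma curve_surj:
  assumes \<theta>: "\<bar>\<theta>\<bar> < pi"
  shows "\<exists>x. Re (H (Complex x (level \<theta> x))) = r"
proof -
  define C where "C = t/2 * (1 + 2 / (1 + cos \<bar>\<theta>\<bar>))"
  have C: "\<bar>Re (H (Complex x (level \<theta> x))) - x\<bar> \<le> C" for x
    using Re_H_bound[of "Complex x (level \<theta> x)" "\<bar>\<theta>\<bar>"] abs_level[OF \<theta>, of x] \<theta> by (simp add: C_def)
  then have "0 \<le> C" using abs_ge_zero order_trans by blast
  have "\<exists>x\<ge>r - C. x \<le> r + C \<and> Re (H (Complex x (level \<theta> x))) = r"
  proof (rule IVT)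
    show "\<forall>x. r - C \<le> x \<and> x \<le> r + C \<longrightarrow> isCont (\<lambda>x. Re (H (Complex x (level \<theta> x)))) x"
      using curve_derivative[OF \<theta>] DERIV_isCont by blast
  qed (use C[of "r - C"] C[of "r + C"] \<open>0 \<le> C\<close> in auto)
  then show ?thesis by blast
qed

lemma Complex_level:
  assumes "z \<in> \<Omega>" shows "Complex (Re z) (level (Im (H z)) (Re z)) = z"
  using level_eqI[of "Im z" "Re z"] assms by (simp add: \<Omega>_def)

lemma H_inj: "inj_on H \<Omega>"
proof (rule inj_onI)
  fix z z' assume zz: "z \<in> \<Omega>" "z' \<in> \<Omega>" "H z = H z'"
  define \<theta> where "\<theta> = Im (H z)"
  have \<theta>: "\<bar>\<theta>\<bar> < pi" using zz by (simp add: \<theta>_def \<Omega>_def)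
  have *: "Complex (Re z) (level \<theta> (Re z)) = z" "Complex (Re z') (level \<theta> (Re z')) = z'"
    using Complex_level[OF zz(1)] Complex_level[OF zz(2)] zz(3) by (simp_all add: \<theta>_def)
  have "Re z = Re z'"
    using curve_strict_mono[OF \<theta>, of "Re z" "Re z'"] curve_strict_mono[OF \<theta>, of "Re z'" "Re z"] zz(3)
    unfolding * by (cases "Re z" "Re z'" rule: linorder_cases) auto
  then show "z = z'" using * by metis
qed

lemma H_image: "H ` \<Omega> = {w. \<bar>Im w\<bar> < pi}"
proof (intro equalityI subsetI)
  fix w assume "w \<in> {w. \<bar>Im w\<bar> < pi}"
  then have w: "\<bar>Im w\<bar> < pi" by simp
  obtain x where x: "Re (H (Complex x (level (Im w) x))) = Re w" using curve_surj[OF w] by blast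
  have "H (Complex x (level (Im w) x)) = w"
    using x Im_H_level[OF w] by (simp add: complex_eq_iff)
  moreover have "Complex x (level (Im w) x) \<in> \<Omega>"
    using abs_level[OF w, of x] w Im_H_level[OF w] by (auto simp: \<Omega>_def)
  ultimately show "w \<in> H ` \<Omega>" by force
qed (auto simp: \<Omega>_def)

lemma open_\<Omega>: "open \<Omega>"
proof -
  have "\<Omega> = {z. \<bar>Im z\<bar> < pi} \<inter> H -` {z. \<bar>Im z\<bar> < pi}" by (auto simp: \<Omega>_def)
  then show ?thesis
    using continuous_open_preimage[OF holomorphic_on_imp_continuous_on[OF H_holomorphic] open_strip open_strip]
    by simp
qed

definition G :: "complex \<Rightarrow> complex" where "G = the_inv_into \<Omega> H"

lemma G_H: "z \<in> \<Omega> \<Longrightarrow> G (H z) = z"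
  unfolding G_def by (rule the_inv_into_f_f[OF H_inj])

lemma
  assumes "\<bar>Im w\<bar> < pi"
  shows H_G: "H (G w) = w" and G_in: "G w \<in> \<Omega>"
  using f_the_inv_into_f[OF H_inj, of w] the_inv_into_into[OF H_inj, of w \<Omega>] assms
  by (auto simp: G_def H_image)

lemma G_holomorphic: "G holomorphic_on {w. \<bar>Im w\<bar> < pi}"
proof -
  have "H holomorphic_on \<Omega>" using H_holomorphic by (rule holomorphic_on_subset) (auto simp: \<Omega>_def)
  then obtain g where g: "g holomorphic_on (H ` \<Omega>)" "\<And>z. z \<in> \<Omega> \<Longrightarrow> g (H z) = z"
    using holomorphic_has_inverse[OF _ open_\<Omega> H_inj] by metis
  show ?thesis
    using g(1) unfolding H_image
    by (rule holomorphic_transform) (use g(2) G_in H_G in \<open>metis mem_Collect_eq\<close>)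
qed

lemma abs_Im_G:
  assumes "\<bar>Im w\<bar> < pi" shows "\<bar>Im (G w)\<bar> \<le> \<bar>Im w\<bar>"
  using Complex_level[OF G_in[OF assms]] abs_level[of "Im w" "Re (G w)"] assms H_G[OF assms]
  by (metis complex.sel(2))

lemma G_cnj: assumes "\<bar>Im w\<bar> < pi" shows "G (cnj w) = cnj (G w)"
proof -
  have "H (cnj (G w)) = cnj w" using H_cnj H_G[OF assms] by simp
  moreover have "cnj (G w) \<in> \<Omega>" using G_in[OF assms] H_G[OF assms] by (simp add: \<Omega>_def H_cnj)
  ultimately show ?thesis using G_H by metis
qed

lemma G_minus: assumes "\<bar>Im w\<bar> < pi" shows "G (- w) = - G w"
proof -
  have i: "\<bar>Im (G w)\<bar> < pi" using G_in[OF assms] by (simp add: \<Omega>_def)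
  have "H (- G w) = - w" using H_minus[OF i] H_G[OF assms] by simp
  moreover have "- G w \<in> \<Omega>" using G_in[OF assms] i by (simp add: \<Omega>_def H_minus)
  ultimately show ?thesis using G_H by metis
qed

lemma Re_G_mono:
  assumes "\<bar>Im w\<bar> < pi" "Im w = Im w'" "Re w \<le> Re w'"
  shows "Re (G w) \<le> Re (G w')"
proof (rule ccontr)
  assume "\<not> ?thesis"
  then have "Re (G w') < Re (G w)" by simp
  from curve_strict_mono[OF assms(1) this]
  have "Re (H (G w')) < Re (H (G w))"
    using Complex_level[OF G_in, of w] Complex_level[OF G_in, of w'] assms H_G by simp
  then show False using assms H_G by simp
qed

text \<open>\<open>R\<close> is to be the function \<open>T\<close> of the measure at time \<open>t\<close>.\<close>

definition R :: "complex \<Rightarrow> complex" where "R w = T (G w)"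

lemma G_eq: assumes "\<bar>Im w\<bar> < pi" shows "G w = w - of_real (t/2) * R w"
  using H_G[OF assms] by (simp add: H_def R_def algebra_simps)

lemma R_holomorphic: "R holomorphic_on {w. \<bar>Im w\<bar> < pi}"
  unfolding R_def[abs_def]
  by (rule holomorphic_on_compose_gen[OF G_holomorphic T_holomorphic, unfolded comp_def])
    (use G_in in \<open>auto simp: \<Omega>_def\<close>)

lemma R_cnj: "\<bar>Im w\<bar> < pi \<Longrightarrow> R (cnj w) = cnj (R w)"
  by (simp add: R_def G_cnj T_cnj)

lemma R_minus: "\<bar>Im w\<bar> < pi \<Longrightarrow> R (- w) = - R w"
  using G_in[of w] by (simp add: R_def G_minus T_minus \<Omega>_def)

lemma norm_R_le:
  assumes "\<bar>Im w\<bar> \<le> \<theta>" "\<theta> < pi" shows "norm (R w) \<le> 1 + 2 / (1 + cos \<theta>)"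
  unfolding R_def using abs_Im_G[of w] assms by (intro norm_T_le) auto

lemma Im_R: assumes "\<bar>Im w\<bar> < pi" shows "Im (R w) = 2/t * (Im w - Im (G w))"
  using arg_cong[OF G_eq[OF assms], of Im] t_pos by (simp add: field_simps)

lemma Im_R_bounds:
  assumes "0 \<le> Im w" "Im w < pi" shows "0 \<le> Im (R w)" "Im (R w) \<le> 4 * pi / t"
proof -
  have "\<bar>Im (G w)\<bar> \<le> Im w" using abs_Im_G[of w] assms by simp
  then have *: "0 \<le> Im w - Im (G w)" "Im w - Im (G w) \<le> 2 * pi" using assms by auto
  then show "0 \<le> Im (R w)" using assms t_pos by (subst Im_R) auto
  have "2/t * (Im w - Im (G w)) \<le> 2/t * (2 * pi)" using * t_pos by (intro mult_left_mono) auto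
  then show "Im (R w) \<le> 4 * pi / t" using assms by (subst Im_R) auto
qed

lemma G_of_real: "G (of_real x) \<in> \<real>" and R_of_real: "R (of_real x) \<in> \<real>"
  using G_cnj[of "of_real x"] R_cnj[of "of_real x"] by (auto simp: complex_is_Real_iff complex_eq_iff)

text \<open>This limit carries the total mass: it will show that the density found for \<open>R\<close> integrates to \<open>1\<close>.\<close>

lemma R_at_top: "((\<lambda>x. Re (R (of_real x))) \<longlongrightarrow> 1) at_top"
proof -
  have G: "G (of_real x) = of_real (Re (G (of_real x)))" for x
    using G_of_real[of x] by simp
  have b: "x - t \<le> Re (G (of_real x))" for x
  proof -
    have "\<bar>Re (R (of_real x))\<bar> \<le> 2"
      using norm_R_le[of "of_real x" 0] abs_Re_le_cmod[of "R (of_real x)"] by simp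
    then have "t/2 * Re (R (of_real x)) \<le> t/2 * 2" using t_pos by (intro mult_left_mono) auto
    then show ?thesis using G_eq[of "of_real x"] by simp
  qed
  have "filterlim (\<lambda>x. x - t) at_top at_top"
    using filterlim_tendsto_add_at_top[OF tendsto_const[of "-t"] filterlim_ident[of at_top]] by simp
  then have "filterlim (\<lambda>x. Re (G (of_real x))) at_top at_top"
    by (rule filterlim_at_top_mono) (use b in auto)
  from filterlim_compose[OF T_at_top this]
  have "((\<lambda>x. T (G (of_real x))) \<longlongrightarrow> 1) at_top" using G by simp
  then show ?thesis unfolding R_def[symmetric] by (auto dest: tendsto_Re)
qed

end

section \<open>Unimodality along the flow\<close>

text \<open>\<open>M\<close> is symmetric unimodal: apart from a possible atom at \<open>0\<close> it has an even density that decreases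
away from \<open>0\<close>.\<close>

locale unimodal_flow = free_flow +
  fixes f :: "real \<Rightarrow> real"
  assumes f_nonneg: "\<And>x. 0 \<le> f x" and f_even: "\<And>x. f (-x) = f x"
    and f_antimono: "antimono_on {0<..} f" and f_measurable [measurable]: "f \<in> borel_measurable borel"
    and emeasure_off_0: "\<And>A. A \<in> sets borel \<Longrightarrow> 0 \<notin> A \<Longrightarrow> emeasure M A = (\<integral>\<^sup>+x\<in>A. ennreal (f x) \<partial>lborel)"
begin

lemma density_off_0: "density M (indicator (-{0})) = density lborel (\<lambda>x. ennreal (f x))"
proof (rule measure_eqI)
  fix A assume "A \<in> sets (density M (indicator (-{0})))"
  then have A [measurable]: "A \<in> sets borel" by simp
  have "emeasure (density M (indicator (-{0}))) A = (\<integral>\<^sup>+x. indicator (A - {0}) x \<partial>M)"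
    by (subst emeasure_density) (auto intro!: nn_integral_cong simp del: nn_integral_indicator split: split_indicator)
  also have "\<dots> = emeasure M (A - {0})" by (subst nn_integral_indicator) auto
  also have "\<dots> = (\<integral>\<^sup>+x\<in>A - {0}. ennreal (f x) \<partial>lborel)" by (rule emeasure_off_0) auto
  also have "\<dots> = (\<integral>\<^sup>+x\<in>A. ennreal (f x) \<partial>lborel)"
    by (rule nn_integral_cong_AE, rule AE_mp[OF AE_lborel_singleton[of 0]]) (auto intro!: AE_I2 split: split_indicator)
  also have "\<dots> = emeasure (density lborel (\<lambda>x. ennreal (f x))) A"
    by (subst emeasure_density) auto
  finally show "emeasure (density M (indicator (-{0}))) A = emeasure (density lborel (\<lambda>x. ennreal (f x))) A" .
qed simp

lemma f_antimono_abs: "x \<noteq> 0 \<Longrightarrow> \<bar>x\<bar> \<le> \<bar>y\<bar> \<Longrightarrow> f y \<le> f x"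
proof -
  assume *: "x \<noteq> 0" "\<bar>x\<bar> \<le> \<bar>y\<bar>"
  have "f y = f \<bar>y\<bar>" "f x = f \<bar>x\<bar>" using f_even by (auto simp: abs_if)
  then show ?thesis using monotone_onD[OF f_antimono, of "\<bar>x\<bar>" "\<bar>y\<bar>"] * by auto
qed

text \<open>This is Wintner's theorem for the kernel \<open>k\<close>.  The difference \<open>D\<close> of the kernels centred at
\<open>x\<close> and \<open>x'\<close> is odd under reflection in the midpoint \<open>h\<close> and nonnegative to its left.  Since
\<open>h \<ge> 0\<close>, the density at a point left of \<open>h\<close> is at least that at its mirror image.  Hence
\<open>2 \<integral> f D = \<integral> (f(s) - f(2h - s)) D(s) ds\<close> has a nonnegative integrand.  The atom at \<open>0\<close> contributes
\<open>D 0 \<ge> 0\<close>.\<close>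

lemma Im_T_antimono:
  assumes "0 \<le> y" "y < pi" "0 \<le> x" "x \<le> x'"
  shows "Im (T (Complex x' y)) \<le> Im (T (Complex x y))"
proof -
  define k where "k x s = sin y / (cosh (x - s) + cos y)" for x s :: real
  define D where "D s = k x s - k x' s" for s
  have int: "integrable M (k x)" for x unfolding k_def using integrable_Im_T[of y x] assms by simp
  have [measurable]: "D \<in> borel_measurable borel"
    unfolding D_def k_def by (intro borel_measurable_continuous_onI continuous_intros)
      (use cosh_plus_cos_pos[of y] assms in \<open>auto simp: less_imp_neq[THEN not_sym]\<close>)
  have kle: "k v s \<le> k u s" if "\<bar>u - s\<bar> \<le> \<bar>v - s\<bar>" for u v s
  proof -
    have "cosh (u - s) \<le> cosh (v - s)"
      using that cosh_real_nonneg_le_iff[of "\<bar>u - s\<bar>" "\<bar>v - s\<bar>"] by simp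
    then show ?thesis unfolding k_def using assms cosh_plus_cos_pos[of y]
      by (intro divide_left_mono mult_pos_pos sin_ge_zero) auto
  qed
  have intD: "integrable M D" unfolding D_def using int by simp
  define p where "p s = indicator (-{0}) s * D s" for s :: real
  have dens: "integrable (density M (indicator (-{0}))) D" 
    "integral\<^sup>L (density M (indicator (-{0}))) D = (\<integral>s. p s \<partial>M)" 
  proof -
    have e: "density M (indicator (-{0})) = density M (\<lambda>s. ennreal (indicator (-{0}) s))" 
      by (simp add: ennreal_indicator)
    show "integrable (density M (indicator (-{0}))) D" unfolding e
      using integrable_mult_indicator[OF _ intD, of "-{0}"] by (subst integrable_density) auto
    show "integral\<^sup>L (density M (indicator (-{0}))) D = (\<integral>s. p s \<partial>M)"
      unfolding e p_def by (subst integral_density) auto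
  qed
  have split: "(\<integral>s. D s \<partial>M) = (\<integral>s. indicator {0} s * D 0 + p s \<partial>M)"
    by (rule Bochner_Integration.integral_cong) (auto simp: p_def split: split_indicator)
  have "integrable M p"
    unfolding p_def using integrable_mult_indicator[OF _ intD, of "-{0}"] by simp
  then have "(\<integral>s. D s \<partial>M) = prob {0} * D 0 + (\<integral>s. p s \<partial>M)"
    unfolding split by (subst Bochner_Integration.integral_add) (auto simp: less_top[symmetric])
  moreover have "0 \<le> D 0" using kle[of x 0 x'] assms by (simp add: D_def)
  moreover have "0 \<le> (\<integral>s. p s \<partial>M)"
  proof -
    define h where "h = (x + x') / 2"
    have ifD: "integrable lborel (\<lambda>s. f s * D s)"
      using dens(1) unfolding density_off_0 by (subst (asm) integrable_density) (auto simp: f_nonneg)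
    have refl: "D (2 * h - s) = - D s" for s
    proof -
      have e: "x - (2 * h - s) = - (x' - s)" "x' - (2 * h - s) = - (x - s)" by (simp_all add: h_def field_simps)
      show ?thesis unfolding D_def k_def e cosh_minus by simp
    qed
    have ifD': "integrable lborel (\<lambda>s. f (2 * h - s) * D s)"
      using lborel_integrable_real_affine[OF ifD, of "-1" "2 * h"] by (simp add: refl)
    have "(\<integral>s. p s \<partial>M) = (\<integral>s. f s * D s \<partial>lborel)"
      using dens(2) unfolding density_off_0 by (subst (asm) integral_density) (auto simp: f_nonneg)
    moreover have "(\<integral>s. f s * D s \<partial>lborel) = - (\<integral>s. f (2 * h - s) * D s \<partial>lborel)"
      by (subst lborel_integral_real_affine[of "-1" _ "2 * h"]) (auto simp: refl)
    moreover have "0 \<le> (\<integral>s. f s * D s - f (2 * h - s) * D s \<partial>lborel)"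
    proof (rule integral_nonneg_AE, rule AE_mp[OF AE_lborel_singleton[of 0]], rule AE_mp[OF AE_lborel_singleton[of "2 * h"]], intro AE_I2 impI)
      fix s assume s: "s \<noteq> 2 * h" "s \<noteq> 0"
      have h0: "h \<ge> 0" using assms by (simp add: h_def)
      show "0 \<le> f s * D s - f (2 * h - s) * D s"
      proof (cases "s \<le> h")
        case True
        then have "0 \<le> D s" unfolding D_def using kle[of x s x'] assms by (auto simp: h_def abs_if)
        moreover have "f (2 * h - s) \<le> f s" using True h0 s by (intro f_antimono_abs) auto
        ultimately show ?thesis by (simp add: mult_right_mono)
      next
        case False
        then have "D s \<le> 0" unfolding D_def using kle[of x' s x] assms by (auto simp: h_def abs_if)
        moreover have "f s \<le> f (2 * h - s)" using False h0 s by (intro f_antimono_abs) auto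
        ultimately show ?thesis by (simp add: mult_right_mono_neg)
      qed
    qed
    ultimately show ?thesis using ifD ifD' by simp
  qed
  ultimately have "0 \<le> (\<integral>s. D s \<partial>M)" by simp
  then have "(\<integral>s. k x' s \<partial>M) \<le> (\<integral>s. k x s \<partial>M)" unfolding D_def using int by simp
  then show ?thesis using assms by (simp add: Im_T k_def)
qed

text \<open>Moving to the right on a horizontal line, \<open>Re G\<close> increases.  At the larger abscissa \<open>Im H\<close> is smaller at equal
height, so the level is reached higher up: \<open>Im G\<close> increases, and \<open>Im R = 2/t (Im w - Im (G w))\<close> decreases.\<close>

lemma Im_R_antimono:
  assumes "0 \<le> y" "y < pi" "0 \<le> u" "u \<le> u'"
  shows "Im (R (Complex u' y)) \<le> Im (R (Complex u y))"
proof -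
  define z z' where "z = G (Complex u y)" and "z' = G (Complex u' y)"
  have s: "\<bar>Im (Complex u y)\<bar> < pi" "\<bar>Im (Complex u' y)\<bar> < pi" "\<bar>Im (Complex 0 y)\<bar> < pi" using assms by auto
  \<comment> \<open>by the two symmetries of \<open>G\<close> the imaginary axis is mapped into itself\<close>
  have "cnj (Complex 0 y) = - Complex 0 y" by (simp add: complex_eq_iff)
  then have "Re (G (Complex 0 y)) = 0"
    using G_cnj[OF s(3)] G_minus[OF s(3)] by (metis complex_cnj_minus minus_equation_iff complex_cnj_cancel_iff cnj.sel(1) uminus_complex.sel(1) equal_neg_zero)
  then have "0 \<le> Re z" using Re_G_mono[of "Complex 0 y" "Complex u y"] assms by (simp add: z_def)
  have zz': "Re z \<le> Re z'" using Re_G_mono[of "Complex u y" "Complex u' y"] assms by (simp add: z_def z'_def)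
  have H: "H z = Complex u y" "H z' = Complex u' y" using H_G s by (simp_all add: z_def z'_def)
  have \<Omega>: "z \<in> \<Omega>" "z' \<in> \<Omega>" unfolding z_def z'_def using G_in s by blast+
  have "0 \<le> Im z"
  proof (rule ccontr)
    assume n: "\<not> 0 \<le> Im z"
    then have "Im (H (Complex (Re z) (Im z))) < 0"
      using Im_H_ge[of "- Im z" "Re z"] Im_H_odd[of "Im z" "Re z"] \<Omega> by (auto simp: \<Omega>_def)
    then show False using H assms by simp
  qed
  have "Im z \<le> Im z'"
  proof (rule ccontr)
    assume n: "\<not> Im z \<le> Im z'"
    have "Im (H (Complex (Re z') (Im z))) \<le> Im (H (Complex (Re z) (Im z)))"
      using Im_T_antimono[of "Im z" "Re z" "Re z'"] \<open>0 \<le> Re z\<close> \<open>0 \<le> Im z\<close> zz' \<Omega> t_pos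
      by (auto simp: Im_H \<Omega>_def)
    also have "\<dots> = y" using H by simp
    finally have "Im (H (Complex (Re z') (Im z'))) < y"
      using n \<Omega> assms by (intro level_crossing[where ?y2.0="Im z"]) (auto simp: \<Omega>_def)
    then show False using H by simp
  qed
  then show ?thesis using t_pos unfolding Im_R[OF s(1)] Im_R[OF s(2)] z_def z'_def
    by (intro mult_left_mono) auto
qed

end

section \<open>Integral representation in a strip\<close>

lemma contour_integral_linepath_horizontal:
  assumes "a < b"
  shows "contour_integral (linepath (Complex a c) (Complex b c)) f = integral {a..b} (\<lambda>x. f (Complex x c))"
proof -
  have l: "linepath (Complex a c) (Complex b c) x = linepath (complex_of_real a) (of_real b) x + \<i> * of_real c" for x
    by (simp add: complex_eq_iff linepath_def algebra_simps)
  have d: "Complex b c - Complex a c = complex_of_real b - of_real a" by (simp add: complex_eq_iff)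
  have "contour_integral (linepath (Complex a c) (Complex b c)) f
      = contour_integral (linepath (complex_of_real a) (of_real b)) (\<lambda>z. f (z + \<i> * of_real c))"
    by (simp only: contour_integral_integral vector_derivative_linepath_at l d) 
  also have "\<dots> = integral {a..b} (\<lambda>x. f (of_real x + \<i> * of_real c))"
    using assms by (subst contour_integral_linepath_Reals_eq) auto
  finally show ?thesis by (simp add: Complex_eq)
qed

lemma exp_eq_one_strip:
  assumes "\<bar>Im z\<bar> < 2 * pi" "exp z = 1" shows "z = 0"
proof -
  obtain n :: int where n: "Re z = 0" "Im z = of_int (2 * n) * pi" using assms(2) by (auto simp: exp_eq_1)
  have "\<bar>of_int n :: real\<bar> < 1" using assms(1) n by (simp add: abs_mult)
  then have "n = 0" by linarith
  then show ?thesis using n by (simp add: complex_eq_iff)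
qed

lemma abs_less_2pi: "- pi \<le> y \<Longrightarrow> y \<le> pi \<Longrightarrow> \<bar>y\<bar> < 2 * pi"
  using pi_gt_zero by linarith

text \<open>The kernel \<open>1 / (exp (z - a) - 1)\<close> has period \<open>2 \<pi> i\<close>, so \<open>a\<close> is its only pole in the rectangle, with
residue \<open>1\<close>.\<close>

lemma rectangle_formula:
  assumes f: "f holomorphic_on {z. \<bar>Im z\<bar> < c}" and c: "pi < c" and a: "\<bar>a\<bar> < L"
  shows "contour_integral (rectpath (Complex (-L) (-pi)) (Complex L pi)) (\<lambda>z. f z / (exp (z - of_real a) - 1))
      = 2 * pi * \<i> * f (of_real a)"
proof -
  define S where "S = {z. \<bar>Im z\<bar> < min c (2 * pi)}"
  let ?g = "rectpath (Complex (-L) (-pi)) (Complex L pi)"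
  let ?F = "\<lambda>z. f z / (exp (z - of_real a) - 1)"
  have S: "S = {z. Im z < min c (2 * pi)} \<inter> {z. Im z > - min c (2 * pi)}"
    by (auto simp: S_def)
  have opS: "open S" unfolding S by (intro open_Int open_halfspace_Im_lt open_halfspace_Im_gt)
  have "convex S" unfolding S by (intro convex_Int convex_halfspace_Im_lt convex_halfspace_Im_gt)
  then have cS: "connected S" by (rule convex_connected)
  have fS: "f holomorphic_on S" using f by (rule holomorphic_on_subset) (auto simp: S_def)
  have nz: "exp (z - of_real a) - 1 \<noteq> 0" if "z \<in> S - {of_real a}" for z
    using exp_eq_one_strip[of "z - of_real a"] that by (auto simp: S_def)
  have hol: "?F holomorphic_on S - {of_real a}"
    using nz by (intro holomorphic_intros holomorphic_on_subset[OF fS]) auto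
  have L: "L > 0" using a by linarith
  have "0 < c" using c pi_gt_zero by linarith
  then have aS: "of_real a \<in> S" by (simp add: S_def)
  have cb: "cbox (Complex (-L) (-pi)) (Complex L pi) \<subseteq> S"
    using c by (auto simp: S_def in_cbox_complex_iff intro: abs_less_2pi)
  have res: "residue ?F (of_real a) = f (of_real a)"
  proof (rule residue_simple'[OF opS aS hol])
    have "(exp has_field_derivative 1) (at (0::complex))" using DERIV_exp[of 0] by simp
    then have "((\<lambda>h. (exp h - 1) / h) \<longlongrightarrow> 1) (at (0::complex))" by (simp add: has_field_derivative_iff)
    then have "((\<lambda>z. (exp (z - of_real a) - 1) / (z - of_real a)) \<longlongrightarrow> 1) (at (complex_of_real a))"
      by (intro LIM_offset_zero_cancel[of _ "of_real a"]) simp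
    moreover have "(f \<longlongrightarrow> f (of_real a)) (at (of_real a))"
      using holomorphic_on_imp_continuous_on[OF fS] opS aS continuous_on_eq_continuous_at isCont_def by blast
    ultimately have "((\<lambda>z. f z / ((exp (z - of_real a) - 1) / (z - of_real a))) \<longlongrightarrow> f (of_real a) / 1) (at (complex_of_real a))"
      by (intro tendsto_divide) auto
    then show "((\<lambda>z. ?F z * (z - of_real a)) \<longlongrightarrow> f (of_real a)) (at (complex_of_real a))" by simp
  qed
  have "contour_integral ?g ?F = 2 * pi * \<i> * (\<Sum>p\<in>{of_real a}. winding_number ?g p * residue ?F p)"
  proof (rule Residue_theorem[OF opS cS _ hol])
    have "path_image ?g \<subseteq> S" using path_image_rectpath_subset_cbox[of "Complex (-L) (-pi)" "Complex L pi"] cb L by auto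
    moreover have "of_real a \<notin> path_image ?g"
      using a L by (subst path_image_rectpath) auto
    ultimately show "path_image ?g \<subseteq> S - {of_real a}" by blast
    show "\<forall>z. z \<notin> S \<longrightarrow> winding_number ?g z = 0"
      using cb L by (intro allI impI winding_number_rectpath_outside) auto
  qed auto
  moreover have "winding_number ?g (of_real a) = 1"
    using a by (intro winding_number_rectpath) (auto simp: in_box_complex_iff)
  ultimately show ?thesis using res by simp
qed

text \<open>A smoothed indicator function of \<open>[-\<omega>, \<omega>]\<close>.\<close>

definition bump :: "real \<Rightarrow> real \<Rightarrow> real" where
  "bump \<omega> x = 1 / (exp (x - \<omega>) + 1) - 1 / (exp (x + \<omega>) + 1)"

lemma bump_eq_htanh: "bump \<omega> x = (htanh (x + \<omega>) - htanh (x - \<omega>)) / 2"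
  by (simp add: bump_def htanh_def)

lemma bump_measurable [measurable]: "bump \<omega> \<in> borel_measurable borel"
  unfolding bump_def[abs_def] by measurable

lemma exp_plus_one_pos: "0 < exp (x::real) + 1" by (simp add: add_pos_pos)

lemma bump_nonneg: "0 \<le> \<omega> \<Longrightarrow> 0 \<le> bump \<omega> x"
  unfolding bump_def using exp_plus_one_pos by (auto intro!: divide_left_mono mult_pos_pos)

lemma bump_even: "bump \<omega> (-x) = bump \<omega> x"
proof -
  have "1 / (exp (-y) + 1) = 1 - 1 / (exp y + 1)" for y :: real
    using exp_plus_one_pos[of y] by (simp add: exp_minus field_simps)
  from this[of "x + \<omega>"] this[of "x - \<omega>"] show ?thesis by (simp add: bump_def)
qed

lemma bump_le_exp: assumes "0 \<le> x" shows "bump \<omega> x \<le> exp \<omega> * exp (-x)"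
proof -
  have "1 / (exp (x - \<omega>) + 1) \<le> 1 / exp (x - \<omega>)"
    using exp_plus_one_pos by (intro divide_left_mono mult_pos_pos) auto
  moreover have "0 \<le> 1 / (exp (x + \<omega>) + 1)" using exp_plus_one_pos[of "x + \<omega>"] by simp
  moreover have "1 / exp (x - \<omega>) = exp \<omega> * exp (-x)" by (simp add: exp_diff exp_minus field_simps)
  ultimately show ?thesis unfolding bump_def by linarith
qed

lemma integrable_bump: assumes "0 \<le> \<omega>" shows "integrable lborel (bump \<omega>)"
proof -
  let ?e = "exponential_density 1"
  have "integrable lborel ?e"
  proof (rule integrableI_nonneg)
    have "prob_space (density lborel ?e)" by (rule prob_space_exponential_density) simp
    then have "emeasure (density lborel ?e) UNIV = 1" using prob_space.emeasure_space_1 by fastforce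
    then show "(\<integral>\<^sup>+x. ennreal (?e x) \<partial>lborel) < \<infinity>" by (simp add: emeasure_density)
  qed auto
  moreover from lborel_integrable_real_affine[OF this, of "-1" 0]
  have "integrable lborel (\<lambda>x. ?e (-x))" by simp
  ultimately have "integrable lborel (\<lambda>x. exp \<omega> * (?e x + ?e (-x)))" by simp
  then show ?thesis
  proof (rule Bochner_Integration.integrable_bound)
    show "AE x in lborel. norm (bump \<omega> x) \<le> norm (exp \<omega> * (?e x + ?e (-x)))"
    proof (rule AE_I2)
      fix x
      have "bump \<omega> x \<le> exp \<omega> * (?e x + ?e (-x))"
      proof (cases "0 \<le> x")
        case True
        have "bump \<omega> x \<le> exp \<omega> * exp (-x)" by (rule bump_le_exp[OF True])
        also have "\<dots> \<le> exp \<omega> * (?e x + ?e (-x))"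
          using True by (intro mult_left_mono) (auto simp: exponential_density_def)
        finally show ?thesis .
      next
        case False
        have "bump \<omega> x \<le> exp \<omega> * exp x" using bump_le_exp[of "-x" \<omega>] bump_even[of \<omega> x] False by simp
        also have "\<dots> \<le> exp \<omega> * (?e x + ?e (-x))"
          using False by (intro mult_left_mono) (auto simp: exponential_density_def)
        finally show ?thesis .
      qed
      then show "norm (bump \<omega> x) \<le> norm (exp \<omega> * (?e x + ?e (-x)))"
        using bump_nonneg[OF assms, of x] by simp
    qed
  qed auto
qed

text \<open>The difference of two kernels with poles at \<open>\<omega>\<close> and \<open>-\<omega>\<close> decays exponentially, so the vertical
sides of long rectangles contribute nothing in the limit for merely bounded \<open>f\<close>.  On the lines \<open>Im z = \<plusminus>\<pi>\<close> it
is the real function \<open>- bump \<omega>\<close>.\<close>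

definition cbump :: "real \<Rightarrow> complex \<Rightarrow> complex" where
  "cbump \<omega> z = 1 / (exp (z - of_real \<omega>) - 1) - 1 / (exp (z + of_real \<omega>) - 1)"

lemma cbump_boundary:
  assumes "y = pi \<or> y = -pi" shows "cbump \<omega> (Complex x y) = - of_real (bump \<omega> x)"
proof -
  have e: "exp (Complex x y + of_real r) = - of_real (exp (x + r))" for r
  proof (rule complex_eqI)
    show "Re (exp (Complex x y + of_real r)) = Re (- of_real (exp (x + r)))"
      using assms by (auto simp: Re_exp)
    show "Im (exp (Complex x y + of_real r)) = Im (- of_real (exp (x + r)))"
      using assms by (auto simp: Im_exp)
  qed
  have "1 / (- complex_of_real r - 1) = - of_real (1 / (r + 1))" for r
  proof -
    have "- complex_of_real r - 1 = - of_real (r + 1)" by simp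
    then show ?thesis by (simp only: divide_minus_right of_real_divide of_real_1)
  qed
  then show ?thesis
    using e[of \<omega>] e[of "-\<omega>"] by (simp add: cbump_def bump_def)
qed

lemma norm_cbump_le:
  assumes "\<bar>Re z\<bar> = L" "\<omega> \<ge> 0" "\<omega> < L"
  shows "norm (cbump \<omega> z) \<le> 2 / (exp (L - \<omega>) - 1)"
proof -
  have right: "norm (cbump \<omega> z) \<le> 2 / (exp (L - \<omega>) - 1)" if z: "Re z = L" for z
  proof -
    have p: "0 < exp (L - \<omega>) - 1" using assms by simp
    have n: "norm (1 / (exp (z + of_real r) - 1)) \<le> 1 / (exp (L - \<omega>) - 1)" if "- \<omega> \<le> r" for r
    proof -
      have "exp (L - \<omega>) - 1 \<le> norm (exp (z + of_real r)) - norm (1::complex)"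
        using z that by simp
      also have "\<dots> \<le> norm (exp (z + of_real r) - 1)" by (rule norm_triangle_ineq2)
      finally show ?thesis using p by (auto simp: norm_divide intro!: divide_left_mono mult_pos_pos)
    qed
    have "norm (cbump \<omega> z) \<le> norm (1 / (exp (z + of_real (-\<omega>)) - 1)) + norm (1 / (exp (z + of_real \<omega>) - 1))"
      unfolding cbump_def using norm_triangle_ineq4 by simp
    also have "\<dots> \<le> 1 / (exp (L - \<omega>) - 1) + 1 / (exp (L - \<omega>) - 1)"
      using assms by (intro add_mono n) auto
    finally show ?thesis by simp
  qed
  have L: "L > 0" using assms by simp
  show ?thesis
  proof (cases "Re z = L")
    case True then show ?thesis by (rule right)
  next
    case False
    then have z: "Re (-z) = L" using assms by auto
    have nz: "exp (w + of_real r) \<noteq> 1" if "Re w = L" "\<bar>r\<bar> \<le> \<omega>" for w r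
    proof
      assume "exp (w + complex_of_real r) = 1"
      then have "norm (exp (w + complex_of_real r)) = 1" by simp
      then show False using that assms by simp
    qed
    have inv: "1 / (exp (-w) - 1) = - 1 - 1 / (exp w - 1)" if "exp w \<noteq> 1" for w :: complex
      using that by (simp add: exp_minus divide_simps) (simp add: algebra_simps)
    have "cbump \<omega> (- (-z)) = cbump \<omega> (-z)"
      using inv[OF nz[OF z, of \<omega>]] inv[OF nz[OF z, of "-\<omega>"]] assms(2)
      by (simp add: cbump_def algebra_simps)
    then show ?thesis using right[OF z] by simp
  qed
qed

text \<open>Integrate \<open>f\<close> times \<open>cbump \<omega>\<close> around the rectangle of width \<open>2 L\<close> and height \<open>2 \<pi>\<close>.  The
residues give the left side.  On the horizontal sides the kernel is real and the values of \<open>f\<close> are conjugate, so only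
the imaginary part of \<open>f\<close> survives.\<close>

lemma strip_representation:
  fixes f :: "complex \<Rightarrow> complex"
  assumes f: "f holomorphic_on {z. \<bar>Im z\<bar> < c}" and c: "pi < c"
    and B: "\<And>z. \<bar>Im z\<bar> \<le> pi \<Longrightarrow> norm (f z) \<le> B"
    and cnj: "\<And>z. \<bar>Im z\<bar> \<le> pi \<Longrightarrow> f (cnj z) = cnj (f z)"
    and \<omega>: "0 \<le> \<omega>"
  shows "f (of_real \<omega>) - f (- of_real \<omega>)
    = of_real (1 / pi * (\<integral>x. Im (f (Complex x pi)) * bump \<omega> x \<partial>lborel))"
proof -
  define F where "F z = f z * cbump \<omega> z" for z
  define q where "q x = Im (f (Complex x pi)) * bump \<omega> x" for x
  have fcont: "continuous_on {z. \<bar>Im z\<bar> < c} f" using f by (rule holomorphic_on_imp_continuous_on)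
  have B0: "0 \<le> B" using order_trans[OF norm_ge_zero B[of 0]] by simp
  have hcont: "continuous_on UNIV (\<lambda>x. f (Complex x y))" if "\<bar>y\<bar> < c" for y
    unfolding Complex_eq by (rule continuous_on_compose2[OF fcont]) (auto intro!: continuous_intros simp: that)
  have qcont: "continuous_on UNIV q" unfolding q_def bump_def
    using hcont[of pi] c exp_plus_one_pos pi_gt_zero by (intro continuous_intros) (auto simp: less_imp_neq[THEN not_sym])
  have qint: "integrable lborel q"
  proof (rule Bochner_Integration.integrable_bound)
    show "integrable lborel (\<lambda>x. B * bump \<omega> x)" using integrable_bump[OF \<omega>] by simp
    show "q \<in> borel_measurable lborel" using borel_measurable_continuous_onI[OF qcont] by simp
    show "AE x in lborel. norm (q x) \<le> norm (B * bump \<omega> x)"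
      using abs_Im_le_cmod order_trans[OF abs_Im_le_cmod B] bump_nonneg[OF \<omega>] B0
      by (intro AE_I2) (auto simp: q_def abs_mult intro!: mult_right_mono)
  qed
  have main: "norm (2 * pi * \<i> * (f (of_real \<omega>) - f (- of_real \<omega>)) - 2 * \<i> * of_real (integral {-L..L} q))
     \<le> 8 * pi * B / (exp (L - \<omega>) - 1)" if L: "\<omega> < L" for L
  proof -
    have L0: "0 < L" using \<omega> L by simp
    define a1 a2 a3 a4 where "a1 = Complex (-L) (-pi)" and "a2 = Complex L (-pi)" and "a3 = Complex L pi" and "a4 = Complex (-L) pi"
    have g: "rectpath a1 a3 = linepath a1 a2 +++ linepath a2 a3 +++ linepath a3 a4 +++ linepath a4 a1"
      by (simp add: rectpath_def Let_def a1_def a2_def a3_def a4_def)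
    have pim: "path_image (rectpath a1 a3) \<subseteq> {z. \<bar>Im z\<bar> < min c (2 * pi)} - {of_real \<omega>, of_real (-\<omega>)}"
      unfolding a1_def a3_def using L0 L \<omega> c pi_gt_zero by (subst path_image_rectpath) (auto intro: abs_less_2pi)
    have seg: "path_image (rectpath a1 a3) = closed_segment a1 a2 \<union> closed_segment a2 a3 \<union> closed_segment a3 a4 \<union> closed_segment a4 a1"
      unfolding g by (simp add: path_image_join Un_assoc)
    have sides: "closed_segment a1 a2 \<subseteq> path_image (rectpath a1 a3)" "closed_segment a2 a3 \<subseteq> path_image (rectpath a1 a3)"
      "closed_segment a3 a4 \<subseteq> path_image (rectpath a1 a3)" "closed_segment a4 a1 \<subseteq> path_image (rectpath a1 a3)"
      unfolding seg by blast+
    have pole: "continuous_on (path_image (rectpath a1 a3)) (\<lambda>z. f z / (exp (z - of_real r) - 1))" if "r = \<omega> \<or> r = -\<omega>" for r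
    proof (intro continuous_intros continuous_on_subset[OF fcont])
      show "path_image (rectpath a1 a3) \<subseteq> {z. \<bar>Im z\<bar> < c}" using pim by auto
      show "\<forall>z\<in>path_image (rectpath a1 a3). exp (z - of_real r) - 1 \<noteq> 0"
      proof
        fix z assume "z \<in> path_image (rectpath a1 a3)"
        then have "z \<noteq> of_real r" "\<bar>Im (z - of_real r)\<bar> < 2 * pi" using pim that by auto
        then show "exp (z - of_real r) - 1 \<noteq> 0" using exp_eq_one_strip[of "z - of_real r"] by auto
      qed
    qed
    have ci: "(\<lambda>z. f z / (exp (z - of_real r) - 1)) contour_integrable_on (rectpath a1 a3)" if r: "r = \<omega> \<or> r = -\<omega>" for r
    proof -
      have side_int: "(\<lambda>z. f z / (exp (z - of_real r) - 1)) contour_integrable_on linepath u v"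
        if "closed_segment u v \<subseteq> path_image (rectpath a1 a3)" for u v
        by (rule contour_integrable_continuous_linepath[OF continuous_on_subset[OF pole[OF r] that]])
      show ?thesis unfolding g
        by (intro contour_integrable_joinI valid_path_join valid_path_linepath side_int sides) simp_all
    qed
    have Feq: "F = (\<lambda>z. f z / (exp (z - of_real \<omega>) - 1) - f z / (exp (z - of_real (-\<omega>)) - 1))"
      by (auto simp: F_def cbump_def fun_eq_iff algebra_simps)
    have "contour_integral (rectpath a1 a3) F = 2 * pi * \<i> * f (of_real \<omega>) - 2 * pi * \<i> * f (of_real (-\<omega>))"
      unfolding Feq
      by (subst contour_integral_diff)
        (use ci[of \<omega>] ci[of "-\<omega>"] rectangle_formula[OF f c, of \<omega> L] rectangle_formula[OF f c, of "-\<omega>" L] L \<omega> in \<open>auto simp: a1_def a3_def\<close>)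
    moreover have Fcont: "continuous_on (path_image (rectpath a1 a3)) F"
      unfolding Feq by (intro continuous_on_diff pole) auto
    then have Fi: "F contour_integrable_on linepath a1 a2" "F contour_integrable_on linepath a2 a3"
      "F contour_integrable_on linepath a3 a4" "F contour_integrable_on linepath a4 a1"
      using contour_integrable_continuous_linepath[OF continuous_on_subset[OF Fcont]] sides by blast+
    have "contour_integral (rectpath a1 a3) F = contour_integral (linepath a1 a2) F + contour_integral (linepath a2 a3) F
      + contour_integral (linepath a3 a4) F + contour_integral (linepath a4 a1) F"
      unfolding g using Fi by (simp add: contour_integrable_joinI)
    moreover have "contour_integral (linepath a1 a2) F + contour_integral (linepath a3 a4) F = 2 * \<i> * of_real (integral {-L..L} q)"
    proof -
      have int: "(\<lambda>x. F (Complex x y)) integrable_on {-L..L}" if "y = pi \<or> y = -pi" for y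
      proof (rule integrable_continuous_real)
        show "continuous_on {-L..L} (\<lambda>x. F (Complex x y))"
          unfolding F_def cbump_boundary[OF that] bump_def using that c exp_plus_one_pos
          by (intro continuous_intros continuous_on_subset[OF hcont]) (auto simp: less_imp_neq[THEN not_sym])
      qed
      have "contour_integral (linepath a1 a2) F = integral {-L..L} (\<lambda>x. F (Complex x (-pi)))"
        unfolding a1_def a2_def using L0 by (subst contour_integral_linepath_horizontal) auto
      moreover have "contour_integral (linepath a3 a4) F = - integral {-L..L} (\<lambda>x. F (Complex x pi))"
        unfolding contour_integral_reverse_linepath[OF continuous_on_subset[OF Fcont sides(3)]]
        unfolding a3_def a4_def using L0 by (subst contour_integral_linepath_horizontal) auto
      ultimately have "contour_integral (linepath a1 a2) F + contour_integral (linepath a3 a4) F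
         = integral {-L..L} (\<lambda>x. F (Complex x (-pi)) - F (Complex x pi))"
        using int by (simp add: Henstock_Kurzweil_Integration.integral_diff)
      also have "(\<lambda>x. F (Complex x (-pi)) - F (Complex x pi)) = (\<lambda>x. 2 * \<i> * of_real (q x))"
      proof
        fix x
        have "Complex x (-pi) = cnj (Complex x pi)" by (simp add: complex_eq_iff)
        then have "f (Complex x (-pi)) = cnj (f (Complex x pi))" using cnj[of "Complex x pi"] by simp
        then show "F (Complex x (-pi)) - F (Complex x pi) = 2 * \<i> * of_real (q x)"
          by (simp add: F_def cbump_boundary q_def complex_eq_iff)
      qed
      also have "integral {-L..L} (\<lambda>x. 2 * \<i> * complex_of_real (q x)) = 2 * \<i> * of_real (integral {-L..L} q)"
      proof -
        have "(q has_integral integral {-L..L} q) {-L..L}"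
          using continuous_on_subset[OF qcont] by (intro integrable_integral integrable_continuous_real) auto
        from has_integral_mult_right[OF has_integral_of_real[OF this], of "2 * \<i>"]
        show ?thesis by (rule integral_unique)
      qed
      finally show ?thesis .
    qed
    ultimately have sides_eq: "2 * pi * \<i> * (f (of_real \<omega>) - f (- of_real \<omega>)) - 2 * \<i> * of_real (integral {-L..L} q)
        = contour_integral (linepath a2 a3) F + contour_integral (linepath a4 a1) F"
      unfolding of_real_minus by algebra
    have vert: "norm (contour_integral (linepath u v) F) \<le> B * (2 / (exp (L - \<omega>) - 1)) * (2 * pi)"
      if uv: "(u = a2 \<and> v = a3) \<or> (u = a4 \<and> v = a1)" for u v
    proof -
      have npi: "\<not> pi \<le> 0" using pi_gt_zero by linarith
      have seg_sub: "z \<in> closed_segment u v \<Longrightarrow> \<bar>Re z\<bar> = L \<and> \<bar>Im z\<bar> \<le> pi" for z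
        using uv L0 npi by (auto simp: a1_def a2_def a3_def a4_def closed_segment_same_Re closed_segment_eq_real_ivl)
      have "norm (contour_integral (linepath u v) F) \<le> B * (2 / (exp (L - \<omega>) - 1)) * norm (v - u)"
      proof (rule contour_integral_bound_linepath)
        show "F contour_integrable_on linepath u v" using Fi uv by auto
        show "0 \<le> B * (2 / (exp (L - \<omega>) - 1))" using B0 L by simp
        show "norm (F z) \<le> B * (2 / (exp (L - \<omega>) - 1))" if "z \<in> closed_segment u v" for z
          unfolding F_def norm_mult using seg_sub[OF that] B[of z] norm_cbump_le[of z L \<omega>] \<omega> L B0
          by (intro mult_mono) auto
      qed
      also have "norm (v - u) = 2 * pi"
        using uv by (auto simp: a1_def a2_def a3_def a4_def cmod_def real_sqrt_mult)
      finally show ?thesis .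
    qed
    have "norm (contour_integral (linepath a2 a3) F + contour_integral (linepath a4 a1) F)
      \<le> B * (2 / (exp (L - \<omega>) - 1)) * (2 * pi) + B * (2 / (exp (L - \<omega>) - 1)) * (2 * pi)"
      by (intro norm_triangle_mono vert) auto
    then show ?thesis unfolding sides_eq by (simp add: field_simps)
  qed
  have lim: "(\<lambda>n. integral {-real n..real n} q) \<longlonglongrightarrow> (\<integral>x. q x \<partial>lborel)"
  proof -
    have "(\<lambda>n. \<integral>x. indicator {-real n..real n} x *\<^sub>R q x \<partial>lborel) \<longlonglongrightarrow> (\<integral>x. q x \<partial>lborel)"
    proof (rule integral_dominated_convergence[where w="\<lambda>x. \<bar>q x\<bar>"])
      show "AE x in lborel. (\<lambda>n. indicator {-real n..real n} x *\<^sub>R q x) \<longlonglongrightarrow> q x"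
      proof (intro AE_I2 tendsto_eventually)
        fix x :: real
        obtain N where N: "\<bar>x\<bar> \<le> real N" using real_arch_simple by blast
        then show "eventually (\<lambda>n. indicator {-real n..real n} x *\<^sub>R q x = q x) sequentially"
          by (auto simp: eventually_sequentially intro!: exI[of _ N] split: split_indicator)
      qed
    qed (use qint in \<open>auto split: split_indicator\<close>)
    moreover have "(\<integral>x. indicator {-real n..real n} x *\<^sub>R q x \<partial>lborel) = integral {-real n..real n} q" for n
      using set_borel_integral_eq_integral(2)[of "{-real n..real n}" q] integrable_mult_indicator[OF _ qint, of "{-real n..real n}"]
      by (simp add: set_lebesgue_integral_def set_integrable_def)
    ultimately show ?thesis by simp
  qed
  have "(\<lambda>n. 2 * pi * \<i> * (f (of_real \<omega>) - f (- of_real \<omega>)) - 2 * \<i> * of_real (integral {-real n..real n} q))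
     \<longlonglongrightarrow> 2 * pi * \<i> * (f (of_real \<omega>) - f (- of_real \<omega>)) - 2 * \<i> * of_real (\<integral>x. q x \<partial>lborel)"
    by (intro tendsto_intros lim)
  moreover have "(\<lambda>n. 2 * pi * \<i> * (f (of_real \<omega>) - f (- of_real \<omega>)) - 2 * \<i> * of_real (integral {-real n..real n} q)) \<longlonglongrightarrow> 0"
  proof (rule Lim_null_comparison)
    obtain N where N: "\<omega> < real N" using reals_Archimedean2 by blast
    show "eventually (\<lambda>n. norm (2 * pi * \<i> * (f (of_real \<omega>) - f (- of_real \<omega>)) - 2 * \<i> * of_real (integral {-real n..real n} q))
       \<le> 8 * pi * B / (exp (real n - \<omega>) - 1)) sequentially"
    proof (rule eventually_sequentiallyI[of N])
      fix n assume "N \<le> n"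
      then have "\<omega> < real n" using N by linarith
      then show "norm (2 * pi * \<i> * (f (of_real \<omega>) - f (- of_real \<omega>)) - 2 * \<i> * of_real (integral {-real n..real n} q))
       \<le> 8 * pi * B / (exp (real n - \<omega>) - 1)" by (rule main)
    qed
    have "filterlim (\<lambda>n. real n - \<omega>) at_top sequentially"
      using filterlim_tendsto_add_at_top[OF tendsto_const[of "-\<omega>"] filterlim_real_sequentially] by simp
    then have "filterlim (\<lambda>n. exp (real n - \<omega>) - 1) at_top sequentially"
      using filterlim_tendsto_add_at_top[OF tendsto_const[of "-1"] filterlim_compose[OF exp_at_top]] by fastforce
    then show "(\<lambda>n. 8 * pi * B / (exp (real n - \<omega>) - 1)) \<longlonglongrightarrow> 0"
      by (intro real_tendsto_divide_at_top[OF tendsto_const])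
  qed
  ultimately have "2 * pi * \<i> * (f (of_real \<omega>) - f (- of_real \<omega>)) - 2 * \<i> * of_real (\<integral>x. q x \<partial>lborel) = 0"
    by (rule LIMSEQ_unique)
  then have "of_real pi * (f (of_real \<omega>) - f (- of_real \<omega>)) = of_real (\<integral>x. q x \<partial>lborel)"
    by (simp add: mult.assoc mult.left_commute[of _ \<i>])
  then have "f (of_real \<omega>) - f (- of_real \<omega>) = of_real (\<integral>x. q x \<partial>lborel) / of_real pi"
    by (simp add: field_simps)
  then show ?thesis by (simp add: q_def)
qed

section \<open>The density of the measure at a positive time\<close>

lemma htanh_real_minus: "htanh (-x) = - htanh (x::real)"
proof -
  have "1 / (exp (-x) + 1) = 1 - 1 / (exp x + 1)"
    using exp_plus_one_pos[of x] by (simp add: exp_minus field_simps)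
  then show ?thesis unfolding htanh_def by linarith
qed

lemma bump_eq_htanh': "bump \<omega> x = (htanh (\<omega> - x) + htanh (\<omega> + x)) / 2"
  using htanh_real_minus[of "\<omega> - x"] by (simp add: bump_eq_htanh add.commute)

lemma bump_mono: "\<omega> \<le> \<omega>' \<Longrightarrow> bump \<omega> x \<le> bump \<omega>' x"
  unfolding bump_def using exp_plus_one_pos by (intro diff_mono divide_left_mono mult_pos_pos) auto

lemma AE_abs_isCont:
  fixes F :: "real \<Rightarrow> real"
  assumes "mono F" shows "AE x in lborel. isCont F \<bar>x\<bar>"
proof (rule AE_I')
  let ?D = "{a. \<not> isCont F a}"
  have "countable (?D \<union> uminus ` ?D)" using mono_ctble_discont[OF assms] by auto
  then show "?D \<union> uminus ` ?D \<in> null_sets lborel" by (rule countable_imp_null_set_lborel)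
  show "{x \<in> space lborel. \<not> isCont F \<bar>x\<bar>} \<subseteq> ?D \<union> uminus ` ?D"
  proof
    fix x assume "x \<in> {x \<in> space lborel. \<not> isCont F \<bar>x\<bar>}"
    then have "x \<in> ?D \<or> - x \<in> ?D" by (auto simp: abs_if split: if_splits)
    then show "x \<in> ?D \<union> uminus ` ?D" using image_eqI[of x uminus "- x" ?D] by auto
  qed
qed

context unimodal_flow
begin

lemma R_isCont: "\<bar>Im w\<bar> < pi \<Longrightarrow> isCont R w"
  using R_holomorphic holomorphic_on_imp_continuous_on open_strip continuous_on_eq_continuous_at by blast

lemma Im_R_even: "\<bar>y\<bar> < pi \<Longrightarrow> Im (R (Complex (-u) y)) = Im (R (Complex u y))"
proof -
  assume y: "\<bar>y\<bar> < pi"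
  have "Complex (-u) y = - cnj (Complex u y)" by (simp add: complex_eq_iff)
  then show ?thesis using R_minus[of "cnj (Complex u y)"] R_cnj[of "Complex u y"] y by simp
qed

text \<open>A sequence of factors below \<open>1\<close> that tends to \<open>1\<close>; after scaling by them \<open>R\<close> is holomorphic across
the closed strip.\<close>

definition shrink :: "nat \<Rightarrow> real" where "shrink n = 1 - 1 / (real n + 2)"

definition q :: "nat \<Rightarrow> real \<Rightarrow> real" where
  "q n x = Im (R (Complex (shrink n * x) (shrink n * pi))) / (2 * pi)"

lemma shrink: "0 < shrink n" "shrink n < 1" by (simp_all add: shrink_def)

lemma shrink_pi: "0 \<le> shrink n * pi" "shrink n * pi < pi" "\<bar>shrink n * pi\<bar> < pi"
  using shrink[of n] by (simp_all add: abs_mult)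

lemma shrink_lim: "shrink \<longlonglongrightarrow> 1"
proof -
  have "(\<lambda>n. 1 - 1 / (real n + 2)) \<longlonglongrightarrow> 1 - 0"
    using filterlim_tendsto_add_at_top[OF tendsto_const[of 2] filterlim_real_sequentially]
    by (intro tendsto_diff tendsto_const real_tendsto_divide_at_top[OF tendsto_const]) (simp add: add.commute)
  then show ?thesis by (simp add: shrink_def[abs_def])
qed

lemma q_nonneg: "0 \<le> q n x" and q_le: "q n x \<le> 2 / t"
  using Im_R_bounds[of "Complex (shrink n * x) (shrink n * pi)"] shrink_pi[of n] t_pos
  by (auto simp: q_def field_simps)

lemma q_even: "q n (-x) = q n x"
  using Im_R_even[of "shrink n * pi" "shrink n * x"] shrink_pi by (simp add: q_def)

lemma q_antimono: "0 \<le> x \<Longrightarrow> x \<le> y \<Longrightarrow> q n y \<le> q n x"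
  unfolding q_def using shrink[of n] shrink_pi[of n]
  by (intro divide_right_mono Im_R_antimono) (auto intro: mult_left_mono)

lemma q_isCont: "isCont (q n) x"
  unfolding q_def using shrink_pi[of n]
  by (intro continuous_intros isCont_Im isCont_o2[OF _ R_isCont]) (auto simp: Complex_eq intro!: continuous_intros)

lemma q_measurable [measurable]: "q n \<in> borel_measurable borel"
  by (intro borel_measurable_continuous_onI continuous_at_imp_continuous_on ballI q_isCont)

lemma q_representation:
  assumes "0 \<le> \<omega>" shows "Re (R (of_real (shrink n * \<omega>))) = (\<integral>x. q n x * bump \<omega> x \<partial>lborel)"
proof -
  define f where "f z = R (of_real (shrink n) * z)" for z
  have im: "\<bar>Im (of_real (shrink n) * z)\<bar> = shrink n * \<bar>Im z\<bar>" for z using shrink[of n] by (simp add: abs_mult)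
  have le: "\<bar>Im (of_real (shrink n) * z)\<bar> \<le> shrink n * pi" if "\<bar>Im z\<bar> \<le> pi" for z
    unfolding im using that shrink[of n] by (intro mult_left_mono) auto
  have "f (of_real \<omega>) - f (- of_real \<omega>) = of_real (1 / pi * (\<integral>x. Im (f (Complex x pi)) * bump \<omega> x \<partial>lborel))"
  proof (rule strip_representation[where c="pi / shrink n" and B="1 + 2 / (1 + cos (shrink n * pi))"])
    show "pi < pi / shrink n" using shrink[of n] by (simp add: field_simps)
    show "f holomorphic_on {z. \<bar>Im z\<bar> < pi / shrink n}"
      unfolding f_def
    proof (rule holomorphic_on_compose_gen[OF _ R_holomorphic, unfolded comp_def])
      show "(*) (complex_of_real (shrink n)) ` {z. \<bar>Im z\<bar> < pi / shrink n} \<subseteq> {w. \<bar>Im w\<bar> < pi}"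
        using shrink[of n] by (auto simp: abs_mult field_simps)
    qed (auto intro!: holomorphic_intros)
    show "norm (f z) \<le> 1 + 2 / (1 + cos (shrink n * pi))" if "\<bar>Im z\<bar> \<le> pi" for z
      unfolding f_def by (rule norm_R_le[OF le[OF that]]) (rule shrink_pi)
    show "f (cnj z) = cnj (f z)" if "\<bar>Im z\<bar> \<le> pi" for z
      using R_cnj[OF order.strict_trans1[OF le[OF that] shrink_pi(2)]] unfolding f_def by simp
  qed fact
  moreover have "f (- of_real \<omega>) = - f (of_real \<omega>)" using R_minus[of "of_real (shrink n) * of_real \<omega>"] by (simp add: f_def)
  moreover have "f (Complex x pi) = R (Complex (shrink n * x) (shrink n * pi))" for x
    unfolding f_def by (rule arg_cong[where f=R]) (simp add: complex_eq_iff)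
  ultimately have "2 * f (of_real \<omega>) = of_real (1 / pi * (\<integral>x. 2 * pi * q n x * bump \<omega> x \<partial>lborel))"
    by (simp add: q_def)
  then have "Re (2 * f (of_real \<omega>)) = 1 / pi * (\<integral>x. 2 * pi * q n x * bump \<omega> x \<partial>lborel)"
    by (simp only: Re_complex_of_real)
  also have "\<dots> = 2 * (\<integral>x. q n x * bump \<omega> x \<partial>lborel)" by (simp add: mult.assoc)
  finally have "Re (f (of_real \<omega>)) = (\<integral>x. q n x * bump \<omega> x \<partial>lborel)" by simp
  then show ?thesis by (simp add: f_def)
qed

text \<open>The approximating densities are bounded by \<open>2 / t\<close> and \<open>bump \<omega>\<close> is integrable.  So pointwise convergence almost
everywhere along the subsequence of Helly's theorem carries the representation of \<open>R \<omega>\<close> over to the limit.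
That no mass has escaped to infinity follows afterwards by letting \<open>\<omega> \<rightarrow> \<infinity>\<close>, where \<open>bump \<omega>\<close> increases to \<open>1\<close> and \<open>R \<omega>\<close> tends to \<open>1\<close>.\<close>

theorem density_exists:
  obtains p :: "real \<Rightarrow> real" where "\<And>x. 0 \<le> p x" "\<And>x. p (-x) = p x"
    "\<And>x y. 0 \<le> x \<Longrightarrow> x \<le> y \<Longrightarrow> p y \<le> p x" "p \<in> borel_measurable borel"
    "integrable lborel p" "(\<integral>x. p x \<partial>lborel) = 1"
    "\<And>\<omega>. R (of_real \<omega>) = of_real (\<integral>x. htanh (\<omega> - x) * p x \<partial>lborel)"
proof -
  \<comment> \<open>Helly's theorem is about increasing functions on the whole line: negate the densities and freeze them left of \<open>0\<close>\<close>
  have "\<exists>s. strict_mono (s::nat \<Rightarrow> nat) \<and> (\<exists>F. (\<forall>x. continuous (at_right x) F) \<and> mono F \<and> (\<forall>x. \<bar>F x\<bar> \<le> 2/t) \<and>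
    (\<forall>x. continuous (at x) F \<longrightarrow> (\<lambda>n. - q (s n) (max 0 x)) \<longlonglongrightarrow> F x))"
  proof (rule Helly_selection)
    show "continuous (at_right x) (\<lambda>x. - q n (max 0 x))" for n x
    proof -
      have "continuous_on UNIV (q n)" by (simp add: continuous_at_imp_continuous_on q_isCont)
      then have "continuous_on UNIV (\<lambda>x. q n (max 0 x))"
        by (rule continuous_on_compose2) (intro continuous_on_max continuous_on_const continuous_on_id, simp)
      then have "isCont (\<lambda>x. - q n (max 0 x)) x"
        by (simp add: continuous_on_eq_continuous_at continuous_minus)
      then show ?thesis by (rule continuous_at_imp_continuous_at_within)
    qed
    show "mono (\<lambda>x. - q n (max 0 x))" for n by (auto intro!: monoI q_antimono)
    show "\<bar>- q n (max 0 x)\<bar> \<le> 2/t" for n x using q_nonneg q_le by simp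
  qed
  then obtain s F where s: "strict_mono s" and F: "mono F"
    and lim: "\<And>x. isCont F x \<Longrightarrow> (\<lambda>n. - q (s n) (max 0 x)) \<longlonglongrightarrow> F x" by blast
  have [measurable]: "F \<in> borel_measurable borel" by (rule borel_measurable_mono[OF F])
  \<comment> \<open>the maximum keeps \<open>p\<close> nonnegative at the jumps of \<open>F\<close>, where the limit says nothing\<close>
  define p where "p x = max 0 (- F \<bar>x\<bar>)" for x
  have p_nonneg: "0 \<le> p x" for x by (simp add: p_def)
  have p_even: "p (-x) = p x" for x by (simp add: p_def)
  have p_anti: "p y \<le> p x" if "0 \<le> x" "x \<le> y" for x y
    using monoD[OF F, of x y] that by (simp add: p_def)
  have [measurable]: "p \<in> borel_measurable borel" unfolding p_def by measurable
  have qabs: "q n \<bar>x\<bar> = q n x" for n x using q_even by (auto simp: abs_if)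
  have conv: "AE x in lborel. (\<lambda>n. q (s n) x) \<longlonglongrightarrow> p x"
    using AE_abs_isCont[OF F]
  proof eventually_elim
    case (elim x)
    have l: "(\<lambda>n. q (s n) x) \<longlonglongrightarrow> - F \<bar>x\<bar>" using tendsto_minus[OF lim[OF elim]] by (simp add: qabs max_def)
    then have "0 \<le> - F \<bar>x\<bar>" by (rule LIMSEQ_le_const) (use q_nonneg in auto)
    with l show ?case by (simp add: p_def)
  qed
  have rep: "Re (R (of_real \<omega>)) = (\<integral>x. p x * bump \<omega> x \<partial>lborel)"
    and pint: "integrable lborel (\<lambda>x. p x * bump \<omega> x)" if \<omega>: "0 \<le> \<omega>" for \<omega>
  proof -
    have conv': "AE x in lborel. (\<lambda>n. q (s n) x * bump \<omega> x) \<longlonglongrightarrow> p x * bump \<omega> x"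
      using conv by eventually_elim (intro tendsto_intros)
    have bd: "AE x in lborel. norm (q (s n) x * bump \<omega> x) \<le> 2/t * bump \<omega> x" for n
      using mult_right_mono[OF q_le bump_nonneg[OF \<omega>]] q_nonneg bump_nonneg[OF \<omega>]
      by (intro AE_I2) (simp add: abs_mult)
    have wi: "integrable lborel (\<lambda>x. 2/t * bump \<omega> x)" using integrable_bump[OF \<omega>] by simp
    have "(\<lambda>n. \<integral>x. q (s n) x * bump \<omega> x \<partial>lborel) \<longlonglongrightarrow> (\<integral>x. p x * bump \<omega> x \<partial>lborel)"
      by (rule integral_dominated_convergence[OF _ _ wi conv' bd]) auto
    then have "(\<lambda>n. Re (R (of_real (shrink (s n) * \<omega>)))) \<longlonglongrightarrow> (\<integral>x. p x * bump \<omega> x \<partial>lborel)"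
      by (simp only: q_representation[OF \<omega>])
    moreover have "(\<lambda>n. Re (R (of_real (shrink (s n) * \<omega>)))) \<longlonglongrightarrow> Re (R (of_real (1 * \<omega>)))"
      using LIMSEQ_subseq_LIMSEQ[OF shrink_lim s] unfolding comp_def
      by (intro tendsto_Re isCont_tendsto_compose[OF R_isCont] tendsto_of_real tendsto_mult tendsto_const) auto
    ultimately have "(\<integral>x. p x * bump \<omega> x \<partial>lborel) = Re (R (of_real (1 * \<omega>)))" by (rule LIMSEQ_unique)
    then show "Re (R (of_real \<omega>)) = (\<integral>x. p x * bump \<omega> x \<partial>lborel)" by simp
    show "integrable lborel (\<lambda>x. p x * bump \<omega> x)"
      by (rule integrable_dominated_convergence[OF _ _ wi conv' bd]) auto
  qed
  have mass: "integrable lborel p" "(\<integral>x. p x \<partial>lborel) = 1"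
  proof -
    have m: "AE x in lborel. mono (\<lambda>n. p x * bump (real n) x)"
      by (intro AE_I2 monoI mult_left_mono bump_mono p_nonneg) simp
    have l: "AE x in lborel. (\<lambda>n. p x * bump (real n) x) \<longlonglongrightarrow> p x"
    proof (intro AE_I2)
      fix x
      have "(\<lambda>n. (htanh (real n - x) + htanh (real n - (-x))) / 2) \<longlonglongrightarrow> (1 + 1) / 2"
        by (intro tendsto_intros filterlim_compose[OF htanh_at_top filterlim_real_sequentially]) simp
      then have "(\<lambda>n. bump (real n) x) \<longlonglongrightarrow> 1" by (simp add: bump_eq_htanh')
      from tendsto_mult[OF tendsto_const this] show "(\<lambda>n. p x * bump (real n) x) \<longlonglongrightarrow> p x" by simp
    qed
    have "(\<lambda>n. Re (R (of_real (real n)))) \<longlonglongrightarrow> 1"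
      by (rule filterlim_compose[OF R_at_top filterlim_real_sequentially])
    then have i: "(\<lambda>n. \<integral>x. p x * bump (real n) x \<partial>lborel) \<longlonglongrightarrow> 1" by (simp only: rep[OF of_nat_0_le_iff])
    show "integrable lborel p" "(\<integral>x. p x \<partial>lborel) = 1"
      using integrable_monotone_convergence[OF pint[OF of_nat_0_le_iff] m l i]
        integral_monotone_convergence[OF pint[OF of_nat_0_le_iff] m l i] by auto
  qed
  have hp: "integrable lborel (\<lambda>x. htanh (c + d * x) * p x)" for c d
    by (rule Bochner_Integration.integrable_bound[OF mass(1)])
      (auto intro!: AE_I2 mult_left_le_one_le simp: abs_mult abs_htanh_le p_nonneg)
  \<comment> \<open>since \<open>p\<close> is even, averaging over \<open>\<plusminus>x\<close> turns \<open>htanh (\<omega> - x)\<close> into \<open>bump \<omega> x\<close>\<close>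
  have hrep: "Re (R (of_real \<omega>)) = (\<integral>x. htanh (\<omega> - x) * p x \<partial>lborel)" if "0 \<le> \<omega>" for \<omega>
  proof -
    have "(\<integral>x. htanh (\<omega> - x) * p x \<partial>lborel) = (\<integral>x. htanh (\<omega> + x) * p x \<partial>lborel)"
      by (subst lborel_integral_real_affine[of "-1" _ 0]) (auto simp: p_even)
    then have "2 * (\<integral>x. htanh (\<omega> - x) * p x \<partial>lborel)
       = (\<integral>x. htanh (\<omega> - x) * p x \<partial>lborel) + (\<integral>x. htanh (\<omega> + x) * p x \<partial>lborel)" by simp
    also have "\<dots> = (\<integral>x. htanh (\<omega> - x) * p x + htanh (\<omega> + x) * p x \<partial>lborel)"
      using hp[of \<omega> "-1"] hp[of \<omega> 1] by simp
    also have "\<dots> = (\<integral>x. 2 * (p x * bump \<omega> x) \<partial>lborel)"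
      by (intro Bochner_Integration.integral_cong) (auto simp: bump_eq_htanh' algebra_simps)
    finally show ?thesis using rep[OF that] by simp
  qed
  have "R (of_real \<omega>) = of_real (\<integral>x. htanh (\<omega> - x) * p x \<partial>lborel)" for \<omega>
  proof -
    have r: "R (of_real \<omega>) = of_real (Re (R (of_real \<omega>)))" using R_of_real[of \<omega>] by simp
    have "Re (R (of_real \<omega>)) = (\<integral>x. htanh (\<omega> - x) * p x \<partial>lborel)"
    proof (cases "0 \<le> \<omega>")
      case False
      have "Re (R (of_real \<omega>)) = - Re (R (of_real (-\<omega>)))" using R_minus[of "of_real \<omega>"] by simp
      also have "\<dots> = - (\<integral>x. htanh (- \<omega> - x) * p x \<partial>lborel)" using hrep[of "-\<omega>"] False by simp
      also have "(\<integral>x. htanh (- \<omega> - x) * p x \<partial>lborel) = (\<integral>x. - (htanh (\<omega> - x) * p x) \<partial>lborel)"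
      proof -
        have "htanh (x - \<omega>) = - htanh (\<omega> - x)" for x
          using htanh_real_minus[of "\<omega> - x"] by simp
        then show ?thesis by (subst lborel_integral_real_affine[of "-1" _ 0]) (simp_all add: p_even)
      qed
      finally show ?thesis by simp
    qed (rule hrep)
    with r show ?thesis by simp
  qed
  then show ?thesis using that[of p] p_nonneg p_even p_anti mass by auto
qed

end

section \<open>The transforms of a measure on the positive half-line\<close>

lemma htanh_strict_mono: "x < y \<Longrightarrow> htanh x < htanh (y::real)"
  unfolding htanh_def using exp_plus_one_pos
  by (intro diff_strict_left_mono divide_strict_left_mono mult_pos_pos) auto

lemma htanh_bounds: "-1 < htanh x" "htanh x < (1::real)"
proof -
  have "0 < 2 / (exp x + 1)" "2 / (exp x + 1) < 2" using exp_plus_one_pos[of x] by (simp_all add: divide_less_eq)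
  then show "-1 < htanh x" "htanh x < (1::real)" unfolding htanh_def by linarith+
qed

lemma htanh_isCont: "isCont htanh (x::real)"
  unfolding htanh_def using exp_plus_one_pos[of x] by (intro continuous_intros) auto

lemma htanh_at_bot: "((\<lambda>x::real. htanh (x + s)) \<longlongrightarrow> -1) at_bot"
proof -
  have "((\<lambda>x::real. - htanh (x - s)) \<longlongrightarrow> -1) at_top" by (intro tendsto_minus htanh_at_top)
  moreover have "- htanh (x - s) = htanh (- x + s)" for x :: real
    using htanh_real_minus[of "x - s"] by simp
  ultimately have "((\<lambda>x::real. htanh (- x + s)) \<longlongrightarrow> -1) at_top" by simp
  then show ?thesis by (subst filterlim_at_bot_mirror)
qed

locale pos_distribution =
  fixes \<mu> :: "real measure"
  assumes prob_on_pos: "prob_on_pos \<mu>"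
begin

sublocale prob_space \<mu> using prob_on_pos by (simp add: prob_on_pos_def)

lemma sets_eq: "sets \<mu> = sets borel_pos" using prob_on_pos by (simp add: prob_on_pos_def)

lemma space_eq: "space \<mu> = {0<..}"
  using sets_eq_imp_space_eq[OF sets_eq] by (simp add: space_restrict_space)

lemma measurable_from_borel: "f \<in> measurable borel N \<Longrightarrow> f \<in> measurable \<mu> N"
  using measurable_restrict_space1[of f borel N "{0<..}"] measurable_cong_sets[OF sets_eq refl] by blast

text \<open>In the coordinate \<open>z = -e\<^sup>x\<close> of the negative axis this is \<open>-(1 + 2 \<psi> z)\<close>.\<close>

definition tanh_mean :: "real \<Rightarrow> real" where "tanh_mean x = (\<integral>s. htanh (x + ln s) \<partial>\<mu>)"

lemma measurable_htanh_ln: "(\<lambda>s. htanh (x + ln s)) \<in> borel_measurable \<mu>"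
  by (rule measurable_from_borel) measurable

lemma integrable_htanh_ln: "integrable \<mu> (\<lambda>s. htanh (x + ln s))"
  by (rule integrable_const_bound[where B=1]) (auto simp: abs_htanh_le measurable_htanh_ln)

lemma tanh_mean_strict_mono: "x < y \<Longrightarrow> tanh_mean x < tanh_mean y"
  unfolding tanh_mean_def using emeasure_space_1
  by (intro integral_less_AE_space integrable_htanh_ln) (auto simp: htanh_strict_mono)

lemma tanh_mean_bounds: "-1 < tanh_mean x" "tanh_mean x < 1"
proof -
  have "(\<integral>s. -1 \<partial>\<mu>) < tanh_mean x" "tanh_mean x < (\<integral>s. 1 \<partial>\<mu>)"
    unfolding tanh_mean_def using emeasure_space_1
    by (intro integral_less_AE_space integrable_htanh_ln; auto simp: htanh_bounds)+
  then show "-1 < tanh_mean x" "tanh_mean x < 1" using prob_space by simp_all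
qed

lemma tanh_mean_isCont: "isCont tanh_mean x"
  unfolding continuous_at_sequentially comp_def tanh_mean_def
proof (intro allI impI)
  fix u assume u: "u \<longlonglongrightarrow> x"
  show "(\<lambda>n. \<integral>s. htanh (u n + ln s) \<partial>\<mu>) \<longlonglongrightarrow> (\<integral>s. htanh (x + ln s) \<partial>\<mu>)"
    by (rule integral_dominated_convergence[where w="\<lambda>_. 1"])
      (auto simp: abs_htanh_le intro!: measurable_htanh_ln AE_I2 isCont_tendsto_compose[OF htanh_isCont] tendsto_intros u)
qed

lemma tanh_mean_at_top: "(tanh_mean \<longlongrightarrow> 1) at_top"
proof -
  have "((\<lambda>x. \<integral>s. htanh (x + ln s) \<partial>\<mu>) \<longlongrightarrow> (\<integral>s. 1 \<partial>\<mu>)) at_top"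
    using htanh_at_top[of "- ln s" for s]
    by (intro integral_dominated_convergence_at_top[where w="\<lambda>_. 1"])
      (auto simp: abs_htanh_le intro: measurable_htanh_ln)
  then show ?thesis using prob_space by (simp add: tanh_mean_def[abs_def])
qed

lemma tanh_mean_at_bot: "(tanh_mean \<longlongrightarrow> -1) at_bot"
proof -
  have "((\<lambda>x. \<integral>s. htanh (- x + ln s) \<partial>\<mu>) \<longlongrightarrow> (\<integral>s. -1 \<partial>\<mu>)) at_top"
    using htanh_at_bot[of "ln s" for s]
    by (intro integral_dominated_convergence_at_top[where w="\<lambda>_. 1"])
      (auto simp: abs_htanh_le filterlim_at_bot_mirror intro: measurable_htanh_ln[of "- x" for x, simplified])
  then show ?thesis using prob_space by (subst filterlim_at_bot_mirror) (simp add: tanh_mean_def[abs_def])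
qed

lemma tanh_mean_surj: assumes "-1 < a" "a < 1" obtains x where "tanh_mean x = a"
proof -
  have "eventually (\<lambda>x. a < tanh_mean x) at_top" using order_tendstoD(1)[OF tanh_mean_at_top assms(2)] .
  then obtain u where u: "\<And>x. u \<le> x \<Longrightarrow> a < tanh_mean x" by (auto simp: eventually_at_top_linorder)
  have "eventually (\<lambda>x. tanh_mean x < a) at_bot" using order_tendstoD(2)[OF tanh_mean_at_bot assms(1)] .
  then obtain l where l: "\<And>x. x \<le> l \<Longrightarrow> tanh_mean x < a" by (auto simp: eventually_at_bot_linorder)
  have "\<exists>x\<ge>min l u. x \<le> u \<and> tanh_mean x = a"
    by (rule IVT) (use l[of "min l u"] u[of u] tanh_mean_isCont in auto)
  then show ?thesis using that by blast
qed

lemma psi_eq: "psi_transform \<mu> (- of_real (exp x)) = of_real (- (1 + tanh_mean x) / 2)"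
proof -
  have "psi_transform \<mu> (- of_real (exp x)) = (\<integral>s. of_real (- (1 + htanh (x + ln s)) / 2) \<partial>\<mu>)"
    unfolding psi_transform_def
  proof (rule Bochner_Integration.integral_cong)
    fix s assume "s \<in> space \<mu>"
    then have s: "s > 0" by (simp add: space_eq)
    have h: "htanh (x + ln s) = 1 - 2 / (exp x * s + 1)" using s by (simp add: htanh_def exp_add)
    have p: "exp x * s + 1 > 0" using s by (simp add: add_pos_pos)
    have "s * - exp x / (1 - s * - exp x) = - (1 + htanh (x + ln s)) / 2"
      unfolding h using p by (simp add: field_simps)
    from arg_cong[OF this, of complex_of_real]
    show "of_real s * - of_real (exp x) / (1 - of_real s * - of_real (exp x)) = complex_of_real (- (1 + htanh (x + ln s)) / 2)"
      by simp
  qed simp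
  also have "\<dots> = of_real (\<integral>s. - (1 + htanh (x + ln s)) / 2 \<partial>\<mu>)" by (rule integral_complex_of_real)
  also have "(\<integral>s. - (1 + htanh (x + ln s)) / 2 \<partial>\<mu>) = - (1 + tanh_mean x) / 2"
    unfolding tanh_mean_def using integrable_htanh_ln prob_space by simp
  finally show ?thesis .
qed

lemma eta_eq: "eta_transform \<mu> (- of_real (exp x)) = - of_real ((1 + tanh_mean x) / (1 - tanh_mean x))"
proof -
  have "1 - tanh_mean x > 0" using tanh_mean_bounds[of x] by simp
  then have "- (1 + tanh_mean x) / 2 / (1 + - (1 + tanh_mean x) / 2) = - ((1 + tanh_mean x) / (1 - tanh_mean x))" by (simp add: field_simps)
  from arg_cong[OF this, of complex_of_real]
  show ?thesis unfolding eta_transform_def psi_eq by simp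
qed

lemma neg_exp_in: "- complex_of_real (exp x) \<in> neg_axis"
  unfolding neg_axis_def by (intro image_eqI[of _ _ "- exp x"]) auto

text \<open>\<open>tanh_mean\<close> is a continuous increasing bijection of the line onto \<open>(-1, 1)\<close>, and \<open>\<eta>\<close> is its composition with
the monotone map \<open>a \<mapsto> -(1 + a) / (1 - a)\<close> onto the negative axis.\<close>

lemma eta_bij: "bij_betw (eta_transform \<mu>) neg_axis neg_axis"
proof -
  have dom: "\<exists>x. z = - complex_of_real (exp x)" if z: "z \<in> neg_axis" for z
  proof -
    obtain r where "r < 0" "z = of_real r" using z unfolding neg_axis_def by auto
    then show ?thesis by (intro exI[of _ "ln (- r)"]) simp
  qed
  have tanh_mean_inj: "tanh_mean x = tanh_mean y \<Longrightarrow> x = y" for x y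
    using tanh_mean_strict_mono[of x y] tanh_mean_strict_mono[of y x] by (cases x y rule: linorder_cases) auto
  have "inj_on (eta_transform \<mu>) neg_axis"
  proof (rule inj_onI)
    fix z w assume zw: "z \<in> neg_axis" "w \<in> neg_axis" "eta_transform \<mu> z = eta_transform \<mu> w"
    obtain x y where xy: "z = - of_real (exp x)" "w = - of_real (exp y)" using dom zw by blast
    have "(1 + tanh_mean x) / (1 - tanh_mean x) = (1 + tanh_mean y) / (1 - tanh_mean y)" using zw(3) unfolding xy eta_eq by (simp only: neg_equal_iff_equal of_real_eq_iff)
    then have "tanh_mean x = tanh_mean y" using tanh_mean_bounds[of x] tanh_mean_bounds[of y] by (simp add: field_simps)
    then show "z = w" using tanh_mean_inj xy by blast
  qed
  moreover have "eta_transform \<mu> ` neg_axis = neg_axis"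
  proof (intro equalityI subsetI)
    fix w assume "w \<in> eta_transform \<mu> ` neg_axis"
    then obtain x where w: "w = - of_real ((1 + tanh_mean x) / (1 - tanh_mean x))" using dom eta_eq by blast
    have "(1 + tanh_mean x) / (1 - tanh_mean x) > 0" using tanh_mean_bounds[of x] by simp
    then show "w \<in> neg_axis" unfolding w neg_axis_def by (intro image_eqI[of _ _ "- ((1 + tanh_mean x) / (1 - tanh_mean x))"]) auto
  next
    fix w assume "w \<in> neg_axis"
    then obtain r where r: "r < 0" "w = of_real r" by (auto simp: neg_axis_def)
    have "-1 < (r + 1) / (r - 1)" "(r + 1) / (r - 1) < 1" using r by (auto simp: field_simps)
    then obtain x where x: "tanh_mean x = (r + 1) / (r - 1)" by (rule tanh_mean_surj)
    have "(1 + tanh_mean x) / (1 - tanh_mean x) = - r" unfolding x using r by (simp add: field_simps)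
    then have "w = eta_transform \<mu> (- of_real (exp x))" unfolding eta_eq r by (simp only: of_real_minus minus_minus)
    then show "w \<in> eta_transform \<mu> ` neg_axis" using neg_exp_in by blast
  qed
  ultimately show ?thesis by (simp add: bij_betw_def)
qed

lemma Sigma_eta:
  "Sigma_transform \<mu> (eta_transform \<mu> (- of_real (exp x))) = - of_real (exp x) / eta_transform \<mu> (- of_real (exp x))"
  unfolding Sigma_transform_def
  using the_inv_into_f_f[OF bij_betw_imp_inj_on[OF eta_bij] neg_exp_in] by simp

lemma neg_axis_eta: assumes "z \<in> neg_axis" obtains x where "z = eta_transform \<mu> (- of_real (exp x))"
proof -
  obtain w where w: "w \<in> neg_axis" "z = eta_transform \<mu> w"
    using assms eta_bij by (auto simp: bij_betw_def)
  obtain r where r: "r < 0" "w = of_real r" using w by (auto simp: neg_axis_def)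
  then have "w = - of_real (exp (ln (- r)))" by simp
  then show ?thesis using that w by blast
qed

lemma eta_eq_iff:
  "eta_transform \<mu> (- of_real (exp x)) = - of_real ((1 + a) / (1 - a)) \<longleftrightarrow> tanh_mean x = a" if "-1 < a" "a < 1"
proof -
  have "eta_transform \<mu> (- of_real (exp x)) = - of_real ((1 + a) / (1 - a)) \<longleftrightarrow> (1 + tanh_mean x) / (1 - tanh_mean x) = (1 + a) / (1 - a)"
    unfolding eta_eq by (simp only: neg_equal_iff_equal of_real_eq_iff)
  also have "\<dots> \<longleftrightarrow> tanh_mean x = a" using tanh_mean_bounds[of x] that by (auto simp: field_simps)
  finally show ?thesis .
qed

lemma resolvent_eq: "(\<integral>s. 1 / (1 + exp x * s) \<partial>\<mu>) = (1 - tanh_mean x) / 2"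
proof -
  have "(\<integral>s. 1 / (1 + exp x * s) \<partial>\<mu>) = (\<integral>s. (1 - htanh (x + ln s)) / 2 \<partial>\<mu>)"
  proof (intro Bochner_Integration.integral_cong refl)
    fix s assume "s \<in> space \<mu>"
    then have "s > 0" by (simp add: space_eq)
    then have "htanh (x + ln s) = 1 - 2 / (1 + exp x * s)" by (simp add: htanh_def exp_add add.commute)
    moreover have "(1 - (1 - 2 / a)) / 2 = 1 / a" for a :: real by simp
    ultimately show "1 / (1 + exp x * s) = (1 - htanh (x + ln s)) / 2" by (simp only:)
  qed
  also have "\<dots> = (1 - tanh_mean x) / 2" unfolding tanh_mean_def using integrable_htanh_ln prob_space by simp
  finally show ?thesis .
qed

lemma integrable_resolvent:
  assumes "0 < y" shows "integrable \<mu> (\<lambda>s. (1 / (1 + s)) ^ n / (1 + y * s))"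
proof (rule integrable_const_bound[where B=1])
  show "(\<lambda>s. (1 / (1 + s)) ^ n / (1 + y * s)) \<in> borel_measurable \<mu>"
    by (rule measurable_from_borel) measurable
  show "AE s in \<mu>. norm ((1 / (1 + s)) ^ n / (1 + y * s)) \<le> 1"
  proof (rule AE_I2)
    fix s assume "s \<in> space \<mu>"
    then have s: "s > 0" by (simp add: space_eq)
    then have "(1 / (1 + s)) ^ n \<le> 1" "1 \<le> 1 + y * s" using assms by (auto intro!: power_le_one)
    then have "(1 / (1 + s)) ^ n \<le> 1 + y * s" by linarith
    then show "norm ((1 / (1 + s)) ^ n / (1 + y * s)) \<le> 1" using s assms by (simp add: divide_le_eq abs_of_pos add_pos_pos)
  qed
qed

lemma resolvent_power_tendsto:
  "((\<lambda>y. \<integral>s. (1 / (1 + s)) ^ n / (1 + y * s) \<partial>\<mu>) \<longlongrightarrow> (\<integral>s. (1 / (1 + s)) ^ n / (1 + 1 * s) \<partial>\<mu>)) (at 1 within {0<..})"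
  unfolding tendsto_at_iff_sequentially comp_def
proof (intro allI impI)
  fix Y :: "nat \<Rightarrow> real" assume Y: "\<forall>i. Y i \<in> {0<..} - {1}" "Y \<longlonglongrightarrow> 1"
  show "(\<lambda>i. \<integral>s. (1 / (1 + s)) ^ n / (1 + Y i * s) \<partial>\<mu>) \<longlonglongrightarrow> (\<integral>s. (1 / (1 + s)) ^ n / (1 + 1 * s) \<partial>\<mu>)"
  proof (rule integral_dominated_convergence[where w="\<lambda>_. 1"])
    show "AE s in \<mu>. (\<lambda>i. (1 / (1 + s)) ^ n / (1 + Y i * s)) \<longlonglongrightarrow> (1 / (1 + s)) ^ n / (1 + 1 * s)"
      by (intro AE_I2 tendsto_intros Y) (simp add: space_eq)
    show "AE s in \<mu>. norm ((1 / (1 + s)) ^ n / (1 + Y i * s)) \<le> 1" for i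
    proof (rule AE_I2)
      fix s assume "s \<in> space \<mu>"
      then have s: "s > 0" by (simp add: space_eq)
      have y: "Y i > 0" using Y by auto
      then have "(1 / (1 + s)) ^ n \<le> 1" "1 \<le> 1 + Y i * s" using s by (auto intro!: power_le_one)
      then have "(1 / (1 + s)) ^ n \<le> 1 + Y i * s" by linarith
      then show "norm ((1 / (1 + s)) ^ n / (1 + Y i * s)) \<le> 1" using s y by (simp add: divide_le_eq abs_of_pos add_pos_pos)
    qed
  qed (auto intro!: measurable_from_borel)
qed

end

section \<open>Uniqueness of the measure with a given transform\<close>

text \<open>On a bounded interval the moments determine the characteristic function, through its Taylor polynomials.\<close>

lemma real_distribution_eqI_moments:
  assumes "real_distribution M1" "real_distribution M2"
    and b1: "AE x in M1. \<bar>x\<bar> \<le> 1" and b2: "AE x in M2. \<bar>x\<bar> \<le> 1"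
    and eq: "\<And>n. (\<integral>x. x ^ n \<partial>M1) = (\<integral>x. x ^ n \<partial>M2)"
  shows "M1 = M2"
proof (rule Levy_uniqueness[OF assms(1,2)], rule ext)
  fix t
  have approx: "cmod (char M t - (\<Sum>k\<le>n. ((\<i> * t)^k / fact k) * (\<integral>x. x^k \<partial>M))) \<le> 2 * \<bar>t\<bar>^n / fact n"
    if M: "real_distribution M" and b: "AE x in M. \<bar>x\<bar> \<le> 1" for M n
  proof -
    interpret real_distribution M by fact
    have int: "integrable M (\<lambda>x. x ^ k)" for k
    proof (rule integrable_const_bound[where B=1])
      show "AE x in M. norm (x ^ k) \<le> 1" using b by eventually_elim (simp add: power_abs power_le_one)
    qed simp
    have "expectation (\<lambda>x. \<bar>x\<bar>^n) \<le> expectation (\<lambda>x. 1)"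
    proof (rule integral_mono_AE)
      show "integrable M (\<lambda>x. \<bar>x\<bar>^n)" using integrable_abs[OF int[of n]] by (simp add: power_abs)
      show "AE x in M. \<bar>x\<bar>^n \<le> 1" using b by eventually_elim (simp add: power_le_one)
    qed simp
    then have "(2*\<bar>t\<bar>^n / fact n) * expectation (\<lambda>x. \<bar>x\<bar>^n) \<le> (2*\<bar>t\<bar>^n / fact n) * 1"
      using prob_space by (intro mult_left_mono) auto
    with char_approx1[of n t, OF int] show ?thesis by simp
  qed
  have "cmod (char M1 t - char M2 t) \<le> 4 * (\<bar>t\<bar>^n / fact n)" for n
  proof -
    define s where "s = (\<Sum>k\<le>n. ((\<i> * t)^k / fact k) * complex_of_real (\<integral>x. x^k \<partial>M1))"
    have "cmod (char M1 t - char M2 t) = cmod ((char M1 t - s) - (char M2 t - s))" by simp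
    also have "\<dots> \<le> cmod (char M1 t - s) + cmod (char M2 t - s)" by (rule norm_triangle_ineq4)
    also have "\<dots> \<le> 2 * \<bar>t\<bar>^n / fact n + 2 * \<bar>t\<bar>^n / fact n"
      using approx[OF assms(1) b1, of n] approx[OF assms(2) b2, of n] unfolding s_def eq by (rule add_mono)
    finally show ?thesis by simp
  qed
  moreover have "(\<lambda>n. 4 * (\<bar>t\<bar>^n / fact n)) \<longlonglongrightarrow> 4 * 0"
    using summable_LIMSEQ_zero[OF summable_exp[of "\<bar>t\<bar>"]]
    by (intro tendsto_mult tendsto_const) (simp add: divide_inverse mult.commute)
  ultimately have "cmod (char M1 t - char M2 t) \<le> 4 * 0" by (intro LIMSEQ_le_const) auto
  then show "char M1 t = char M2 t" by simp
qed

text \<open>The moments of \<open>1 / (1 + s)\<close> determine the measure.  They arise from the resolvent integrals by induction: the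
partial fraction identity
\<open>1 / ((1 + s)(1 + y s)) = (1 / (1 + s) - y / (1 + y s)) / (1 - y)\<close> raises the power by one for \<open>y \<noteq> 1\<close>, and
\<open>y = 1\<close> follows by continuity.\<close>

theorem pos_distribution_eqI:
  assumes m: "prob_on_pos \<mu>" and n: "prob_on_pos \<nu>"
    and eq: "\<And>y. 0 < y \<Longrightarrow> (\<integral>s. 1 / (1 + y * s) \<partial>\<mu>) = (\<integral>s. 1 / (1 + y * s) \<partial>\<nu>)"
  shows "\<mu> = \<nu>"
proof -
  interpret m: pos_distribution \<mu> by unfold_locales fact
  interpret n: pos_distribution \<nu> by unfold_locales fact
  have rec: "(\<integral>s. (1 / (1 + s)) ^ Suc k / (1 + y * s) \<partial>\<rho>)
      = ((\<integral>s. (1 / (1 + s)) ^ k / (1 + 1 * s) \<partial>\<rho>) - y * (\<integral>s. (1 / (1 + s)) ^ k / (1 + y * s) \<partial>\<rho>)) / (1 - y)"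
    if "prob_on_pos \<rho>" and y: "0 < y" "y \<noteq> 1" for \<rho> k y
  proof -
    interpret pos_distribution \<rho> by unfold_locales fact
    have "(\<integral>s. (1 / (1 + s)) ^ Suc k / (1 + y * s) \<partial>\<rho>)
       = (\<integral>s. ((1 / (1 + s)) ^ k / (1 + 1 * s) - y * ((1 / (1 + s)) ^ k / (1 + y * s))) / (1 - y) \<partial>\<rho>)"
    proof (intro Bochner_Integration.integral_cong refl)
      fix s assume "s \<in> space \<rho>"
      then have s: "s > 0" by (simp add: space_eq)
      then have p: "1 + s \<noteq> 0" "1 + y * s \<noteq> 0" "1 - y \<noteq> 0" using y by (auto simp: add_pos_pos less_imp_neq[THEN not_sym])
      have "1 / (1 + s) / (1 + y * s) = (1 / (1 + 1 * s) - y * (1 / (1 + y * s))) / (1 - y)"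
        using p by (simp add: divide_simps) (simp add: algebra_simps)
      then have "(1 / (1 + s)) ^ k * (1 / (1 + s) / (1 + y * s)) = (1 / (1 + s)) ^ k * ((1 / (1 + 1 * s) - y * (1 / (1 + y * s))) / (1 - y))"
        by simp
      then show "(1 / (1 + s)) ^ Suc k / (1 + y * s) = ((1 / (1 + s)) ^ k / (1 + 1 * s) - y * ((1 / (1 + s)) ^ k / (1 + y * s))) / (1 - y)"
        by (simp add: algebra_simps)
    qed
    also have "\<dots> = ((\<integral>s. (1 / (1 + s)) ^ k / (1 + 1 * s) \<partial>\<rho>) - y * (\<integral>s. (1 / (1 + s)) ^ k / (1 + y * s) \<partial>\<rho>)) / (1 - y)"
      using integrable_resolvent[of 1 k] integrable_resolvent[of y k] y by (simp del: times_divide_eq_right)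
    finally show ?thesis .
  qed
  have all: "(\<integral>s. (1 / (1 + s)) ^ k / (1 + y * s) \<partial>\<mu>) = (\<integral>s. (1 / (1 + s)) ^ k / (1 + y * s) \<partial>\<nu>)" if "0 < y" for k y
    using that
  proof (induction k arbitrary: y)
    case 0 then show ?case using eq by simp
  next
    case (Suc k)
    have ne: "(\<integral>s. (1 / (1 + s)) ^ Suc k / (1 + y * s) \<partial>\<mu>) = (\<integral>s. (1 / (1 + s)) ^ Suc k / (1 + y * s) \<partial>\<nu>)"
      if "0 < y" "y \<noteq> 1" for y
      using rec[OF m that] rec[OF n that] Suc.IH[of 1] Suc.IH[of y] that by (simp del: power_Suc)
    show ?case
    proof (cases "y = 1")
      case True
      have "((\<lambda>y. \<integral>s. (1 / (1 + s)) ^ Suc k / (1 + y * s) \<partial>\<mu>) \<longlongrightarrow> (\<integral>s. (1 / (1 + s)) ^ Suc k / (1 + 1 * s) \<partial>\<nu>)) (at 1 within {0<..})"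
        using n.resolvent_power_tendsto[of "Suc k"]
        by (rule Lim_transform_eventually) (auto simp: eventually_at ne simp del: power_Suc intro!: exI[of _ 1])
      moreover have "at (1::real) within {0<..} \<noteq> bot"
        using at_within_open[of "1::real" "{0<..}"] by simp
      ultimately show ?thesis using m.resolvent_power_tendsto[of "Suc k"] tendsto_unique True by blast
    qed (use ne Suc.prems in blast)
  qed
  have moments: "(\<integral>s. (1 / (1 + s)) ^ k \<partial>\<mu>) = (\<integral>s. (1 / (1 + s)) ^ k \<partial>\<nu>)" for k
  proof (cases k)
    case 0 then show ?thesis using m.prob_space n.prob_space by simp
  next
    case (Suc j) then show ?thesis using all[of 1 j] by (simp add: mult.commute)
  qed
  define w where "w s = 1 / (1 + s)" for s :: real
  \<comment> \<open>the inverse of \<open>w\<close>, with an arbitrary positive value outside its range\<close>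
  define g where "g u = (if 0 < u \<and> u < 1 then 1 / u - 1 else 1)" for u :: real
  have [measurable]: "w \<in> borel_measurable borel" "g \<in> borel_measurable borel" unfolding w_def[abs_def] g_def[abs_def] by measurable
  have g_pos: "g \<in> measurable borel borel_pos"
    by (rule measurable_restrict_space2) (auto simp: g_def field_simps)
  have recover: "distr (distr \<rho> borel w) borel_pos g = \<rho>" if "prob_on_pos \<rho>" for \<rho>
  proof -
    interpret pos_distribution \<rho> by unfold_locales fact
    have "distr (distr \<rho> borel w) borel_pos g = distr \<rho> borel_pos (g \<circ> w)"
      by (rule distr_distr) (auto intro: g_pos measurable_from_borel)
    also have "\<dots> = distr \<rho> borel_pos (\<lambda>s. s)"
      by (rule distr_cong) (auto simp: space_eq g_def w_def field_simps)
    also have "\<dots> = \<rho>" by (rule distr_id2) (simp add: sets_eq)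
    finally show ?thesis .
  qed
  have "distr \<mu> borel w = distr \<nu> borel w"
  proof (rule real_distribution_eqI_moments)
    show "real_distribution (distr \<mu> borel w)" by (intro m.real_distribution_distr m.measurable_from_borel) simp
    show "real_distribution (distr \<nu> borel w)" by (intro n.real_distribution_distr n.measurable_from_borel) simp
    show "AE x in distr \<mu> borel w. \<bar>x\<bar> \<le> 1"
      by (subst AE_distr_iff) (auto intro!: m.measurable_from_borel AE_I2 simp: m.space_eq w_def)
    show "AE x in distr \<nu> borel w. \<bar>x\<bar> \<le> 1"
      by (subst AE_distr_iff) (auto intro!: n.measurable_from_borel AE_I2 simp: n.space_eq w_def)
    show "(\<integral>x. x ^ k \<partial>distr \<mu> borel w) = (\<integral>x. x ^ k \<partial>distr \<nu> borel w)" for k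
      using moments[of k] by (subst (1 2) integral_distr) (auto intro!: m.measurable_from_borel n.measurable_from_borel simp: w_def)
  qed
  then show ?thesis using recover[OF m] recover[OF n] by metis
qed

text \<open>Since \<open>\<Sigma>(z) = \<eta>\<^sup>-\<^sup>1(z) / z\<close>, equal \<open>\<Sigma>\<close>-transforms force equal \<open>\<eta>\<close>, hence equal resolvent integrals.\<close>

theorem Sigma_transform_inj:
  assumes m: "prob_on_pos \<mu>" and n: "prob_on_pos \<nu>"
    and eq: "\<And>z. z \<in> neg_axis \<Longrightarrow> Sigma_transform \<mu> z = Sigma_transform \<nu> z"
  shows "\<mu> = \<nu>"
proof (rule pos_distribution_eqI[OF m n])
  interpret m: pos_distribution \<mu> by unfold_locales fact
  interpret n: pos_distribution \<nu> by unfold_locales fact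
  have AA: "m.tanh_mean x = n.tanh_mean x" for x
  proof -
    define z where "z = eta_transform \<mu> (- of_real (exp x))"
    have z: "z \<in> neg_axis" unfolding z_def using m.eta_bij m.neg_exp_in bij_betwE by blast
    then have "z \<noteq> 0" by (auto simp: neg_axis_def)
    obtain x' where x': "z = eta_transform \<nu> (- of_real (exp x'))" using n.neg_axis_eta[OF z] .
    have "- complex_of_real (exp x) / z = - of_real (exp x') / z"
      using eq[OF z] m.Sigma_eta[of x, folded z_def] n.Sigma_eta[of x', folded x'] by simp
    then have "x = x'" using \<open>z \<noteq> 0\<close>
      by (simp only: divide_cancel_right neg_equal_iff_equal of_real_eq_iff exp_inj_iff simp_thms)
    then have "eta_transform \<nu> (- of_real (exp x)) = - of_real ((1 + m.tanh_mean x) / (1 - m.tanh_mean x))"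
      using x' unfolding z_def m.eta_eq by simp
    then show ?thesis using n.eta_eq_iff[OF m.tanh_mean_bounds] by simp
  qed
  fix y :: real assume "0 < y"
  then show "(\<integral>s. 1 / (1 + y * s) \<partial>\<mu>) = (\<integral>s. 1 / (1 + y * s) \<partial>\<nu>)"
    using m.resolvent_eq[of "ln y"] n.resolvent_eq[of "ln y"] AA by simp
qed

section \<open>Existence of the measure at a positive time\<close>

text \<open>The mode \<open>a\<close> of a symmetric unimodal measure need not be \<open>0\<close>: the density may be constant on
\<open>[-\<bar>a\<bar>, \<bar>a\<bar>]\<close>.  On the half-line \<open>S\<close> with end point \<open>0\<close> that lies away from \<open>a\<close> the given density
is monotone and there is no atom.  By symmetry its even extension from \<open>S\<close> is a density off \<open>0\<close>.\<close>

lemma symmetric_unimodal_density: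
  assumes M: "symmetric_distribution M" and u: "unimodal_mode M a"
  shows "\<exists>f. (\<forall>x. 0 \<le> f x) \<and> (\<forall>x. f (-x) = f x) \<and> antimono_on {0<..} f \<and> f \<in> borel_measurable borel \<and>
    (\<forall>A\<in>sets borel. 0 \<notin> A \<longrightarrow> emeasure M A = (\<integral>\<^sup>+x\<in>A. ennreal (f x) \<partial>lborel))"
proof -
  interpret symmetric_distribution M by fact
  obtain c f0 where f0: "\<And>x. 0 \<le> f0 x" "mono_on {..<a} f0" "antimono_on {a<..} f0"
    and em: "\<And>A. A \<in> sets borel \<Longrightarrow> emeasure M A = c * indicator A a + (\<integral>\<^sup>+x\<in>A. ennreal (f0 x) \<partial>lborel)"
    using u unfolding unimodal_mode_def by blast
  \<comment> \<open>the sign that turns the side away from \<open>a\<close> into the negative half-line\<close>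
  define \<sigma> :: real where "\<sigma> = (if 0 \<le> a then 1 else -1)"
  have \<sigma>: "\<sigma> = 1 \<and> 0 \<le> a \<or> \<sigma> = -1 \<and> a < 0" by (auto simp: \<sigma>_def)
  define S where "S = {x. \<sigma> * x < 0}"
  define h where "h x = indicator S x *\<^sub>R f0 x" for x
  define f where "f x = h (- \<sigma> * \<bar>x\<bar>)" for x
  have S: "S = (if 0 \<le> a then {..<0} else {0<..})" by (auto simp: S_def \<sigma>_def)
  have S_meas [measurable]: "S \<in> sets borel" unfolding S by simp
  have "f0 \<in> borel_measurable (restrict_space borel S)"
  proof (cases "0 \<le> a")
    case True
    then have "mono_on S f0" using f0(2) by (auto simp: S intro: monotone_on_subset)
    then show ?thesis by (rule borel_measurable_mono_on_fnc)
  next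
    case False
    then have "antimono_on S f0" using f0(3) by (auto simp: S intro: monotone_on_subset)
    then have "mono_on S (\<lambda>x. - f0 x)" by (auto simp: monotone_on_def)
    then have "(\<lambda>x. - f0 x) \<in> borel_measurable (restrict_space borel S)" by (rule borel_measurable_mono_on_fnc)
    from borel_measurable_uminus[OF this] show ?thesis by simp
  qed
  then have [measurable]: "h \<in> borel_measurable borel"
    unfolding h_def[abs_def] by (subst (asm) borel_measurable_restrict_space_iff) auto
  have [measurable]: "f \<in> borel_measurable borel" unfolding f_def by measurable
  have f_even: "f (-x) = f x" for x by (simp add: f_def)
  have fS: "f x = f0 x" if "x \<in> S" for x
    using that \<sigma> by (auto simp: f_def h_def S_def)
  have side: "emeasure M A = (\<integral>\<^sup>+x\<in>A. ennreal (f x) \<partial>lborel)" if "A \<in> sets borel" "A \<subseteq> S" for A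
  proof -
    have "a \<notin> A" using that \<sigma> by (auto simp: S)
    then have "emeasure M A = (\<integral>\<^sup>+x\<in>A. ennreal (f0 x) \<partial>lborel)" using em[OF that(1)] by simp
    also have "\<dots> = (\<integral>\<^sup>+x\<in>A. ennreal (f x) \<partial>lborel)"
      using that fS by (intro nn_integral_cong) (auto split: split_indicator)
    finally show ?thesis .
  qed
  have mirror: "emeasure M A = (\<integral>\<^sup>+x\<in>A. ennreal (f x) \<partial>lborel)" if A: "A \<in> sets borel" "uminus -` A \<subseteq> S" for A
  proof -
    have [measurable]: "A \<in> sets borel" by fact
    have A': "uminus -` A \<in> sets borel" using measurable_sets[of uminus borel borel A] A by simp
    have "emeasure M A = emeasure (distr M borel uminus) A" by (simp add: distr_uminus)
    also have "\<dots> = emeasure M (uminus -` A)" using A by (subst emeasure_distr) auto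
    also have "\<dots> = (\<integral>\<^sup>+x\<in>uminus -` A. ennreal (f x) \<partial>lborel)" using A A' by (intro side) auto
    also have "\<dots> = (\<integral>\<^sup>+x. ennreal (f x) * indicator A (- x) \<partial>lborel)"
      by (intro nn_integral_cong) (auto split: split_indicator)
    also have "\<dots> = (\<integral>\<^sup>+x\<in>A. ennreal (f x) \<partial>lborel)"
      by (subst nn_integral_real_affine[of _ "-1" 0]) (auto simp: f_even)
    finally show ?thesis .
  qed
  have "emeasure M A = (\<integral>\<^sup>+x\<in>A. ennreal (f x) \<partial>lborel)" if A: "A \<in> sets borel" "0 \<notin> A" for A
  proof -
    have [measurable]: "A \<in> sets borel" by fact
    have nS: "x \<in> A \<Longrightarrow> x \<notin> S \<Longrightarrow> - x \<in> S" for x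
      using \<sigma> A(2) by (cases "x = 0") (auto simp: S_def)
    have "A = (A \<inter> S) \<union> (A - S)" by auto
    then have "emeasure M A = emeasure M ((A \<inter> S) \<union> (A - S))" by simp
    also have "\<dots> = emeasure M (A \<inter> S) + emeasure M (A - S)"
      by (intro plus_emeasure[symmetric]) auto
    also have "emeasure M (A \<inter> S) = (\<integral>\<^sup>+x\<in>A \<inter> S. ennreal (f x) \<partial>lborel)" by (rule side) auto
    also have "emeasure M (A - S) = (\<integral>\<^sup>+x\<in>A - S. ennreal (f x) \<partial>lborel)"
      by (rule mirror) (use nS in force)+
    also have "(\<integral>\<^sup>+x\<in>A \<inter> S. ennreal (f x) \<partial>lborel) + (\<integral>\<^sup>+x\<in>A - S. ennreal (f x) \<partial>lborel)
       = (\<integral>\<^sup>+x. ennreal (f x) * indicator (A \<inter> S) x + ennreal (f x) * indicator (A - S) x \<partial>lborel)"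
      by (rule nn_integral_add[symmetric]) auto
    also have "\<dots> = (\<integral>\<^sup>+x\<in>A. ennreal (f x) \<partial>lborel)"
      by (intro nn_integral_cong) (auto split: split_indicator)
    finally show ?thesis .
  qed
  moreover have "antimono_on {0<..} f"
  proof (rule monotone_onI)
    fix x y :: real assume xy: "x \<in> {0<..}" "y \<in> {0<..}" "x \<le> y"
    then have f: "f x = f0 (- \<sigma> * x)" "f y = f0 (- \<sigma> * y)" using \<sigma> by (auto simp: f_def h_def S_def)
    show "f y \<le> f x" unfolding f
      using \<sigma> xy monotone_onD[OF f0(2), of "- y" "- x"] monotone_onD[OF f0(3), of x y] by auto
  qed
  moreover have "0 \<le> f x" for x by (simp add: f_def h_def f0)
  moreover have "f \<in> borel_measurable borel" by measurable
  ultimately show ?thesis using f_even by blast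
qed

lemma exp_measurable_pos: "exp \<in> measurable borel borel_pos"
  by (rule measurable_restrict_space2) auto

lemma symmetric_distribution_log:
  assumes "prob_on_pos \<nu>" "mult_symmetric \<nu>"
  shows "symmetric_distribution (distr \<nu> borel ln)"
proof -
  interpret pos_distribution \<nu> by unfold_locales fact
  have ln: "ln \<in> borel_measurable \<nu>" by (rule measurable_from_borel) measurable
  have inv: "(\<lambda>x. 1 / x) \<in> measurable \<nu> borel_pos"
  proof -
    have "(\<lambda>x::real. 1 / x) \<in> measurable borel_pos borel_pos"
      by (rule measurable_restrict_space2, simp add: space_restrict_space, rule measurable_restrict_space1) measurable
    then show ?thesis using measurable_cong_sets[OF sets_eq refl] by blast
  qed
  interpret L: real_distribution "distr \<nu> borel ln" by (rule real_distribution_distr[OF ln])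
  have "distr (distr \<nu> borel ln) borel uminus = distr \<nu> borel (uminus \<circ> ln)"
    using ln by (intro distr_distr) auto
  also have "\<dots> = distr \<nu> borel (ln \<circ> (\<lambda>x. 1 / x))"
  proof (rule distr_cong[OF refl refl])
    fix s assume "s \<in> space \<nu>"
    then have "s > 0" by (simp add: space_eq)
    then show "(uminus \<circ> ln) s = (ln \<circ> (\<lambda>x. 1 / x)) s" by (simp add: ln_div)
  qed
  also have "\<dots> = distr (mult_inverse \<nu>) borel ln"
    unfolding mult_inverse_def
    by (rule distr_distr[OF measurable_restrict_space1 inv, symmetric]) measurable
  also have "mult_inverse \<nu> = \<nu>" using assms(2) by (simp add: mult_symmetric_def)
  finally show ?thesis by unfold_locales
qed

lemma mult_symmetric_distr_exp:
  assumes [simp]: "sets M = sets borel" and sym: "distr M borel uminus = M"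
  shows "mult_symmetric (distr M borel_pos exp)"
proof -
  have e: "exp \<in> measurable M borel_pos" using exp_measurable_pos measurable_cong_sets[OF assms(1) refl] by blast
  have u: "uminus \<in> measurable M borel" by (subst measurable_cong_sets[OF assms(1) refl]) measurable
  have inv: "(\<lambda>x::real. 1 / x) \<in> measurable borel_pos borel_pos"
    by (rule measurable_restrict_space2, simp add: space_restrict_space, rule measurable_restrict_space1) measurable
  have "mult_inverse (distr M borel_pos exp) = distr M borel_pos ((\<lambda>x. 1 / x) \<circ> exp)"
    unfolding mult_inverse_def by (rule distr_distr[OF inv e])
  also have "\<dots> = distr M borel_pos (exp \<circ> uminus)"
    by (rule distr_cong) (auto simp: exp_minus inverse_eq_divide)
  also have "\<dots> = distr (distr M borel uminus) borel_pos exp"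
    by (rule distr_distr[OF exp_measurable_pos u, symmetric])
  finally show ?thesis by (simp add: mult_symmetric_def sym)
qed

lemma distr_exp_ln:
  assumes [simp]: "sets M = sets borel" shows "distr (distr M borel_pos exp) borel ln = M"
proof -
  have e: "exp \<in> measurable M borel_pos" using exp_measurable_pos measurable_cong_sets[OF assms(1) refl] by blast
  have "distr (distr M borel_pos exp) borel ln = distr M borel (ln \<circ> exp)"
    by (rule distr_distr[OF measurable_restrict_space1 e]) measurable
  also have "\<dots> = M" by (rule trans[OF distr_cong distr_id2]) auto
  finally show ?thesis .
qed

text \<open>The measure is the image under \<open>exp\<close> of the density representing \<open>R\<close>.  Its \<open>tanh_mean\<close> at
\<open>y = x + t/2 T x\<close> is \<open>R (H x) = T x\<close>, so that \<open>\<eta>\<^sub>\<rho>(-e\<^sup>y) = \<eta>\<^sub>\<nu>(-e\<^sup>x)\<close>.  Hence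
\<open>\<Sigma>\<close> is multiplied by \<open>e\<^sup>y / e\<^sup>x\<close>, which is \<open>exp (t/2 T x)\<close>.\<close>

theorem free_flow_measure_exists:
  assumes \<nu>: "prob_on_pos \<nu>" "mult_symmetric \<nu>" "log_unimodal \<nu>" and t: "0 < t"
  shows "\<exists>\<rho>. prob_on_pos \<rho> \<and> mult_symmetric \<rho> \<and> log_unimodal \<rho> \<and>
    (\<forall>z\<in>neg_axis. Sigma_transform \<rho> z = exp (complex_of_real t / 2 * ((z + 1) / (z - 1))) * Sigma_transform \<nu> z)"
proof -
  interpret N: pos_distribution \<nu> by unfold_locales fact
  define M where "M = distr \<nu> borel ln"
  have ln_meas: "ln \<in> borel_measurable \<nu>" by (rule N.measurable_from_borel) measurable
  have sd: "symmetric_distribution M" unfolding M_def by (rule symmetric_distribution_log[OF \<nu>(1,2)])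
  obtain a where "unimodal_mode M a" using \<nu>(3) by (auto simp: log_unimodal_def log_unimodal_mode_def M_def)
  from symmetric_unimodal_density[OF sd this] obtain f where
    f: "\<And>x. 0 \<le> f x" "\<And>x. f (-x) = f x" "antimono_on {0<..} f" "f \<in> borel_measurable borel"
    "\<And>A. A \<in> sets borel \<Longrightarrow> 0 \<notin> A \<Longrightarrow> emeasure M A = (\<integral>\<^sup>+x\<in>A. ennreal (f x) \<partial>lborel)" by blast
  interpret symmetric_distribution M by (rule sd)
  interpret unimodal_flow M t f by unfold_locales (use t f in auto)
  obtain p where p: "\<And>x. 0 \<le> p x" "\<And>x. p (-x) = p x"
    "\<And>x y. 0 \<le> x \<Longrightarrow> x \<le> y \<Longrightarrow> p y \<le> p x" "p \<in> borel_measurable borel"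
    "integrable lborel p" "(\<integral>x. p x \<partial>lborel) = 1"
    "\<And>\<omega>. R (of_real \<omega>) = of_real (\<integral>x. htanh (\<omega> - x) * p x \<partial>lborel)"
    using density_exists by blast
  note [measurable] = p(4)
  define P where "P = density lborel (\<lambda>x. ennreal (p x))"
  have sets_P [simp]: "sets P = sets borel" by (simp add: P_def)
  have P_sym: "distr P borel uminus = P"
  proof -
    have "P = density (distr lborel borel uminus) (\<lambda>x. ennreal (p x))" unfolding P_def by (simp only: lborel_distr_uminus)
    also have "\<dots> = distr (density lborel (\<lambda>x. ennreal (p (- x)))) borel uminus" by (rule density_distr) auto
    finally show ?thesis by (simp add: p(2) P_def)
  qed
  have "emeasure P (space P) = 1"
  proof -
    have "emeasure P (space P) = (\<integral>\<^sup>+x. ennreal (p x) \<partial>lborel)" by (simp add: P_def emeasure_density)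
    also have "\<dots> = ennreal (\<integral>x. p x \<partial>lborel)" using p(1,5) by (intro nn_integral_eq_integral) auto
    finally show ?thesis using p(6) by simp
  qed
  then interpret P: prob_space P by (rule prob_spaceI)
  define \<rho> where "\<rho> = distr P borel_pos exp"
  have e: "exp \<in> measurable P borel_pos" using exp_measurable_pos measurable_cong_sets[OF sets_P refl] by blast
  have \<rho>: "prob_on_pos \<rho>" using P.prob_space_distr[OF e] by (simp add: prob_on_pos_def \<rho>_def)
  interpret Q: pos_distribution \<rho> by unfold_locales fact
  have "unimodal_mode P 0"
    unfolding unimodal_mode_def
  proof (intro conjI exI[of _ 0] exI[of _ p] allI ballI)
    show "mono_on {..<0} p"
    proof (rule monotone_onI)
      fix x y :: real assume "x \<in> {..<0}" "y \<in> {..<0}" "x \<le> y"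
      then have "p (- x) \<le> p (- y)" by (intro p(3)) auto
      then show "p x \<le> p y" by (simp add: p(2))
    qed
    show "antimono_on {0<..} p" by (intro monotone_onI p(3)) auto
    show "emeasure P A = 0 * indicator A 0 + (\<integral>\<^sup>+x\<in>A. ennreal (p x) \<partial>lborel)" if "A \<in> sets borel" for A
      using that by (simp add: P_def emeasure_density)
  qed (use p(1) in auto)
  then have "log_unimodal_mode \<rho> 1"
    by (simp add: log_unimodal_mode_def \<rho>_def distr_exp_ln)
  then have lu: "log_unimodal \<rho>" by (auto simp: log_unimodal_def)
  have ms: "mult_symmetric \<rho>" unfolding \<rho>_def by (rule mult_symmetric_distr_exp[OF sets_P P_sym])
  have AN: "of_real (N.tanh_mean x) = T (of_real x)" for x
  proof -
    have "N.tanh_mean x = (\<integral>s. htanh (x + s) \<partial>M)" unfolding N.tanh_mean_def M_def by (subst integral_distr[OF ln_meas]) auto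
    also have "\<dots> = (\<integral>s. htanh (x + s) \<partial>(distr M borel uminus))" by (simp only: distr_uminus)
    also have "\<dots> = (\<integral>s. htanh (x - s) \<partial>M)" by (subst integral_distr) auto
    finally show ?thesis by (simp add: T_of_real)
  qed
  have AQ: "of_real (Q.tanh_mean x) = R (of_real x)" for x
  proof -
    have "Q.tanh_mean x = (\<integral>s. htanh (x + ln (exp s)) \<partial>P)"
      unfolding Q.tanh_mean_def unfolding \<rho>_def
      by (subst integral_distr[OF e]) (auto intro!: measurable_restrict_space1)
    also have "\<dots> = (\<integral>s. p s * htanh (x + s) \<partial>lborel)"
      unfolding P_def by (subst integral_density) (auto simp: p(1))
    also have "\<dots> = (\<integral>s. htanh (x - s) * p s \<partial>lborel)"
      by (subst lborel_integral_real_affine[of "-1" _ 0]) (auto simp: p(2) mult.commute)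
    finally show ?thesis using p(7) by simp
  qed
  have "Sigma_transform \<rho> z = exp (complex_of_real t / 2 * ((z + 1) / (z - 1))) * Sigma_transform \<nu> z"
    if z: "z \<in> neg_axis" for z
  proof -
    obtain x where x: "z = eta_transform \<nu> (- of_real (exp x))" using N.neg_axis_eta[OF z] .
    define a where "a = N.tanh_mean x"
    define y where "y = x + t / 2 * a"
    have a: "-1 < a" "a < 1" using N.tanh_mean_bounds by (simp_all add: a_def)
    have z_a: "z = - of_real ((1 + a) / (1 - a))" unfolding x N.eta_eq a_def ..
    have Hx: "H (of_real x) = of_real y" by (simp add: H_def AN[symmetric] y_def a_def)
    have "of_real x \<in> \<Omega>" by (simp add: \<Omega>_def Hx)
    then have "G (of_real y) = of_real x" using G_H Hx by metis
    then have "complex_of_real (Q.tanh_mean y) = of_real (N.tanh_mean x)" by (simp only: AQ AN R_def)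
    then have "Q.tanh_mean y = a" by (simp only: of_real_eq_iff a_def)
    then have z_y: "z = eta_transform \<rho> (- of_real (exp y))" using Q.eta_eq[of y] z_a by simp
    define b where "b = (1 + a) / (1 - a)"
    have r: "- b + 1 = a * (- b - 1)" "- b - 1 \<noteq> 0"
      using a by (simp_all add: b_def field_simps)
    have "(z + 1) / (z - 1) = of_real ((- b + 1) / (- b - 1))"
      unfolding z_a b_def[symmetric] by simp
    also have "\<dots> = of_real a" using r by simp
    finally have ratio: "(z + 1) / (z - 1) = of_real a" .
    have "Sigma_transform \<rho> z = - of_real (exp y) / z" using Q.Sigma_eta[of y] unfolding z_y .
    also have "exp y = exp (t / 2 * a) * exp x" by (simp add: y_def exp_add)
    also have "- of_real (exp (t / 2 * a) * exp x) / z = of_real (exp (t / 2 * a)) * (- of_real (exp x) / z)" by simp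
    also have "- of_real (exp x) / z = Sigma_transform \<nu> z" using N.Sigma_eta[of x] unfolding x by simp
    also have "of_real (exp (t / 2 * a)) = exp (complex_of_real t / 2 * ((z + 1) / (z - 1)))"
      unfolding ratio by (simp add: exp_of_real[symmetric])
    finally show ?thesis .
  qed
  then show ?thesis using \<rho> ms lu by blast
qed

section \<open>Free multiplicative Brownian motion\<close>

lemma unit_mass:
  shows prob_on_pos_unit_mass: "prob_on_pos (return borel_pos 1)"
    and mult_symmetric_unit_mass: "mult_symmetric (return borel_pos 1)"
    and log_unimodal_unit_mass: "log_unimodal (return borel_pos 1)"
    and Sigma_unit_mass: "z \<in> neg_axis \<Longrightarrow> Sigma_transform (return borel_pos 1) z = 1"
proof -
  have one: "(1::real) \<in> space borel_pos" by (simp add: space_restrict_space)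
  have inv: "(\<lambda>x::real. 1 / x) \<in> measurable borel_pos borel_pos"
    by (rule measurable_restrict_space2, simp add: space_restrict_space, rule measurable_restrict_space1) measurable
  have ln: "ln \<in> borel_measurable borel_pos" by (rule measurable_restrict_space1) measurable
  show pr: "prob_on_pos (return borel_pos 1)"
    using prob_space_return[OF one] by (simp add: prob_on_pos_def)
  show "mult_symmetric (return borel_pos 1)"
    unfolding mult_symmetric_def mult_inverse_def using distr_return[OF inv one] by simp
  have "unimodal_mode (return borel 0) 0"
    unfolding unimodal_mode_def
    by (intro conjI exI[of _ 1] exI[of _ "\<lambda>_. 0"]) (auto simp: monotone_on_def)
  then have "log_unimodal_mode (return borel_pos 1) 1"
    unfolding log_unimodal_mode_def using distr_return[OF ln one] by simp
  then show "log_unimodal (return borel_pos 1)" by (auto simp: log_unimodal_def)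
  interpret pos_distribution "return borel_pos 1" by unfold_locales (rule pr)
  have "tanh_mean x = htanh x" for x
    unfolding tanh_mean_def by (subst integral_return[OF one]) (auto intro!: measurable_restrict_space1)
  moreover have "(1 + htanh x) / (1 - htanh x) = exp x" for x :: real
    using exp_plus_one_pos[of x] by (simp add: htanh_def field_simps)
  ultimately have eta: "eta_transform (return borel_pos 1) (- of_real (exp x)) = - of_real (exp x)" for x
    by (simp add: eta_eq)
  assume z: "z \<in> neg_axis"
  obtain x where x: "z = eta_transform (return borel_pos 1) (- of_real (exp x))" using neg_axis_eta[OF z] .
  have "- complex_of_real (exp x) \<noteq> 0" by (simp only: neg_equal_0_iff_equal of_real_eq_0_iff exp_not_eq_zero not_False_eq_True)
  then show "Sigma_transform (return borel_pos 1) z = 1"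
    using Sigma_eta[of x] unfolding x eta by simp
qed

text \<open>\<open>\<sigma>\<^sub>t\<close> is the measure at time \<open>t\<close> started at \<open>\<delta>\<^sub>1\<close>.\<close>

lemma free_mult_BM_properties:
  assumes "0 < t"
  shows "log_unimodal (free_mult_BM t)"
    and "\<And>z. z \<in> neg_axis \<Longrightarrow> Sigma_transform (free_mult_BM t) z = exp (complex_of_real t / 2 * ((z + 1) / (z - 1)))"
proof -
  obtain \<rho> where \<rho>: "prob_on_pos \<rho>" "log_unimodal \<rho>"
    "\<And>z. z \<in> neg_axis \<Longrightarrow> Sigma_transform \<rho> z = exp (complex_of_real t / 2 * ((z + 1) / (z - 1)))"
    using free_flow_measure_exists[OF unit_mass(1-3) assms] Sigma_unit_mass by auto
  have "free_mult_BM t = \<rho>"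
    unfolding free_mult_BM_def
    by (rule the_equality) (use \<rho> in \<open>auto intro: Sigma_transform_inj\<close>)
  with \<rho> show "log_unimodal (free_mult_BM t)"
    "\<And>z. z \<in> neg_axis \<Longrightarrow> Sigma_transform (free_mult_BM t) z = exp (complex_of_real t / 2 * ((z + 1) / (z - 1)))" by auto
qed

theorem theorem4p2:
  "(\<forall>\<nu> :: real measure.
      prob_on_pos \<nu> \<and> mult_symmetric \<nu> \<and> log_unimodal \<nu> \<longrightarrow>
      (\<forall>t>0. mult_symmetric (free_mult_BM t \<boxtimes> \<nu>) \<and> log_unimodal (free_mult_BM t \<boxtimes> \<nu>)))
   \<and> (\<forall>t>0. log_unimodal (free_mult_BM t))"
proof (intro conjI allI impI)
  fix \<nu> :: "real measure" and t :: real
  assume \<nu>: "prob_on_pos \<nu> \<and> mult_symmetric \<nu> \<and> log_unimodal \<nu>" and t: "0 < t"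
  obtain \<rho> where \<rho>: "prob_on_pos \<rho>" "mult_symmetric \<rho>" "log_unimodal \<rho>"
    "\<And>z. z \<in> neg_axis \<Longrightarrow> Sigma_transform \<rho> z = exp (complex_of_real t / 2 * ((z + 1) / (z - 1))) * Sigma_transform \<nu> z"
    using free_flow_measure_exists[of \<nu> t] \<nu> t by blast
  have "free_mult_BM t \<boxtimes> \<nu> = \<rho>"
    unfolding free_mult_conv_def
    by (rule the_equality)
      (use \<rho> free_mult_BM_properties(2)[OF t] in \<open>auto intro: Sigma_transform_inj\<close>)
  with \<rho> show "mult_symmetric (free_mult_BM t \<boxtimes> \<nu>)" "log_unimodal (free_mult_BM t \<boxtimes> \<nu>)" by auto
qed (rule free_mult_BM_properties(1))

end
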